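(* There exist sequences $(C_t)_{t\in\mathbb{N}}$ and $(\varepsilon_t)_{t\in\mathbb{N}}$ of reals with $C_t > 0$, $\varepsilon_t \in (0,1/e)$ and $\varepsilon_t \to 0$ as $t\to\infty$, such that for every $t \in \mathbb{N}$ the following holds. Let $\varphi$ be any satisfiable $\mathrm{GF}$-sentence, let $\sigma_{\mathrm{nf}}$ be its expanded normal-form signature, and let $k = \mathrm{wd}(\sigma_{\mathrm{nf}})$. If $k \ge t \ge 2$, then $\varphi$ has a finite model whose domain size is at most \[ C_t \cdot \bigl|\boldsymbol{\tau}^{\sigma_{\mathrm{nf}}}_{k}\bigr|^{\,1 - 1/e + \varepsilon_t}. \]
   Context: First-order logic with equality, relation and constant symbols, no function symbols. The Guarded Fragment $\mathrm{GF}$ is the smallest set of formulas containing all atomic formulas (including equality), closed under Boolean connectives, and such that if $\psi\in\mathrm{GF}$, $\bar x$ is a tuple of variables and $\gamma$ is an atom containing all variables of $\bar x$ and all free variables of $\psi$, then $\exists\bar x(\gamma\wedge\psi)$ and $\forall\bar x(\gamma\to\psi)$ are in $\mathrm{GF}$. A signature $\sigma = \mathrm{Rels}\uplus\mathrm{Cons}$ is a finite set of relation symbols $\mathrm{Rels}$ (nonempty, each of arity $\ge 1$) and constant symbols $\mathrm{Cons}$; its width $\mathrm{wd}(\sigma)$ is the maximal arity of a relation symbol in it. The induced signature $\sigma$ of a sentence $\varphi$ is the set of relation and constant symbols occurring in $\varphi$. The expanded normal-form signature $\sigma_{\mathrm{nf}}$ of $\varphi$ is obtained from $\sigma$ by adding,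 for every subformula $\chi$ of $\varphi$ that begins with a maximal block of quantifiers and has at least one free variable, a fresh relation symbol $R_\chi$ whose arity is the number of free variables of $\chi$. For $k\in\mathbb{N}$, let $\mathrm{Lit}_k(\sigma)$ be the set of all atoms $R(t_1,\dots,t_{\mathrm{ar}(R)})$ with $R\in\mathrm{Rels}$ and each $t_i\in\{x_1,\dots,x_k\}\cup\mathrm{Cons}$, together with their negations (no equality literals). A $k$-type over $\sigma$ is a subset of $\mathrm{Lit}_k(\sigma)$ containing, for each such atom, exactly one of the atom and its negation; $\boldsymbol{\tau}^{\sigma}_k$ is the set of all $k$-types over $\sigma$ (so $|\boldsymbol{\tau}^{\sigma}_k| = \prod_{R\in\mathrm{Rels}} 2^{(k+|\mathrm{Cons}|)^{\mathrm{ar}(R)}}$). *)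

theory Defs
  imports Complex_Main "HOL-Library.Countable_Set"
begin

section \<open>First-order logic with equality, relation symbols and constants\<close>

datatype 'c tm = Var nat | Const 'c

text \<open>The set functions \<open>rsyms\<close> and \<open>csyms\<close> collect the relation and constant symbols
  occurring in a formula.\<close>

datatype (rsyms: 'r, csyms: 'c) fm =
    Rel 'r "'c tm list"
  | Eq "'c tm" "'c tm"
  | Neg "('r, 'c) fm"
  | And "('r, 'c) fm" "('r, 'c) fm"
  | Or "('r, 'c) fm" "('r, 'c) fm"
  | Imp "('r, 'c) fm" "('r, 'c) fm"
  | Iff "('r, 'c) fm" "('r, 'c) fm"
  | Ex nat "('r, 'c) fm"
  | All nat "('r, 'c) fm"

primrec tm_vars :: "'c tm \<Rightarrow> nat set" where
  "tm_vars (Var x) = {x}"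
| "tm_vars (Const c) = {}"

primrec fv :: "('r, 'c) fm \<Rightarrow> nat set" where
  "fv (Rel R ts) = (\<Union>t\<in>set ts. tm_vars t)"
| "fv (Eq t u) = tm_vars t \<union> tm_vars u"
| "fv (Neg \<phi>) = fv \<phi>"
| "fv (And \<phi> \<psi>) = fv \<phi> \<union> fv \<psi>"
| "fv (Or \<phi> \<psi>) = fv \<phi> \<union> fv \<psi>"
| "fv (Imp \<phi> \<psi>) = fv \<phi> \<union> fv \<psi>"
| "fv (Iff \<phi> \<psi>) = fv \<phi> \<union> fv \<psi>"
| "fv (Ex x \<phi>) = fv \<phi> - {x}"
| "fv (All x \<phi>) = fv \<phi> - {x}"

definition sentence :: "('r, 'c) fm \<Rightarrow> bool" where
  "sentence \<phi> \<longleftrightarrow> fv \<phi> = {}"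

record ('r, 'c, 'a) struct =
  domain :: "'a set"
  rel_int :: "'r \<Rightarrow> 'a list set"
  const_int :: "'c \<Rightarrow> 'a"

definition is_struct :: "('r \<Rightarrow> nat) \<Rightarrow> ('r, 'c, 'a) struct \<Rightarrow> bool" where
  "is_struct ar M \<longleftrightarrow>
     domain M \<noteq> {} \<and>
     (\<forall>R. rel_int M R \<subseteq> {as. length as = ar R \<and> set as \<subseteq> domain M}) \<and>
     (\<forall>c. const_int M c \<in> domain M)"

primrec tm_val :: "('r, 'c, 'a) struct \<Rightarrow> (nat \<Rightarrow> 'a) \<Rightarrow> 'c tm \<Rightarrow> 'a" where
  "tm_val M s (Var x) = s x"
| "tm_val M s (Const c) = const_int M c"

primrec sat :: "('r, 'c, 'a) struct \<Rightarrow> (nat \<Rightarrow> 'a) \<Rightarrow> ('r, 'c) fm \<Rightarrow> bool" where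
  "sat M s (Rel R ts) \<longleftrightarrow> map (tm_val M s) ts \<in> rel_int M R"
| "sat M s (Eq t u) \<longleftrightarrow> tm_val M s t = tm_val M s u"
| "sat M s (Neg \<phi>) \<longleftrightarrow> \<not> sat M s \<phi>"
| "sat M s (And \<phi> \<psi>) \<longleftrightarrow> sat M s \<phi> \<and> sat M s \<psi>"
| "sat M s (Or \<phi> \<psi>) \<longleftrightarrow> sat M s \<phi> \<or> sat M s \<psi>"
| "sat M s (Imp \<phi> \<psi>) \<longleftrightarrow> (sat M s \<phi> \<longrightarrow> sat M s \<psi>)"
| "sat M s (Iff \<phi> \<psi>) \<longleftrightarrow> (sat M s \<phi> \<longleftrightarrow> sat M s \<psi>)"
| "sat M s (Ex x \<phi>) \<longleftrightarrow> (\<exists>a\<in>domain M. sat M (s(x := a)) \<phi>)"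
| "sat M s (All x \<phi>) \<longleftrightarrow> (\<forall>a\<in>domain M. sat M (s(x := a)) \<phi>)"

definition is_model :: "('r \<Rightarrow> nat) \<Rightarrow> ('r, 'c, 'a) struct \<Rightarrow> ('r, 'c) fm \<Rightarrow> bool" where
  "is_model ar M \<phi> \<longleftrightarrow> is_struct ar M \<and> (\<forall>s. range s \<subseteq> domain M \<longrightarrow> sat M s \<phi>)"

text \<open>HOL cannot quantify over the type of domain elements inside a definition, so domains are
  arbitrary nonempty sets of natural numbers. This is no restriction: by
  \<open>model_imp_satisfiable\<close> below (downward Loewenheim-Skolem), a model over any type
  whatsoever makes a sentence satisfiable in this sense.\<close>

definition satisfiable :: "('r \<Rightarrow> nat) \<Rightarrow> ('r, 'c) fm \<Rightarrow> bool" where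
  "satisfiable ar \<phi> \<longleftrightarrow> (\<exists>M :: ('r, 'c, nat) struct. is_model ar M \<phi>)"


section \<open>The guarded fragment\<close>

inductive atomic :: "('r \<Rightarrow> nat) \<Rightarrow> ('r, 'c) fm \<Rightarrow> bool" for ar where
  "length ts = ar R \<Longrightarrow> atomic ar (Rel R ts)"
| "atomic ar (Eq t u)"

inductive GF :: "('r \<Rightarrow> nat) \<Rightarrow> ('r, 'c) fm \<Rightarrow> bool" for ar where
  "atomic ar \<alpha> \<Longrightarrow> GF ar \<alpha>"
| "GF ar \<phi> \<Longrightarrow> GF ar (Neg \<phi>)"
| "GF ar \<phi> \<Longrightarrow> GF ar \<psi> \<Longrightarrow> GF ar (And \<phi> \<psi>)"
| "GF ar \<phi> \<Longrightarrow> GF ar \<psi> \<Longrightarrow> GF ar (Or \<phi> \<psi>)"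
| "GF ar \<phi> \<Longrightarrow> GF ar \<psi> \<Longrightarrow> GF ar (Imp \<phi> \<psi>)"
| "GF ar \<phi> \<Longrightarrow> GF ar \<psi> \<Longrightarrow> GF ar (Iff \<phi> \<psi>)"
| "GF ar \<psi> \<Longrightarrow> atomic ar \<gamma> \<Longrightarrow> set xs \<union> fv \<psi> \<subseteq> fv \<gamma> \<Longrightarrow>
     GF ar (foldr Ex xs (And \<gamma> \<psi>))"
| "GF ar \<psi> \<Longrightarrow> atomic ar \<gamma> \<Longrightarrow> set xs \<union> fv \<psi> \<subseteq> fv \<gamma> \<Longrightarrow>
     GF ar (foldr All xs (Imp \<gamma> \<psi>))"


section \<open>Signatures\<close>

record ('r, 'c) sig =
  rels :: "'r set"
  arity :: "'r \<Rightarrow> nat"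
  cons :: "'c set"

definition signature :: "('r, 'c) sig \<Rightarrow> bool" where
  "signature \<sigma> \<longleftrightarrow>
     finite (rels \<sigma>) \<and> rels \<sigma> \<noteq> {} \<and> (\<forall>R\<in>rels \<sigma>. arity \<sigma> R \<ge> 1) \<and> finite (cons \<sigma>)"

definition wd :: "('r, 'c) sig \<Rightarrow> nat" where
  "wd \<sigma> = Max (arity \<sigma> ` rels \<sigma>)"

definition induced_sig :: "('r \<Rightarrow> nat) \<Rightarrow> ('r, 'c) fm \<Rightarrow> ('r, 'c) sig" where
  "induced_sig ar \<phi> = \<lparr>rels = rsyms \<phi>, arity = ar, cons = csyms \<phi>\<rparr>"

text \<open>\<open>block_subfms False \<phi>\<close> is the set of subformulas of \<open>\<phi>\<close> that begin with a maximal block of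
  quantifiers. The flag records whether the current subformula stands directly below a quantifier;
  if so, a leading quantifier only continues the block above it. In guarded formulas the scope of
  a block is a conjunction or an implication, so a block never mixes the two quantifiers.\<close>

primrec block_subfms :: "bool \<Rightarrow> ('r, 'c) fm \<Rightarrow> ('r, 'c) fm set" where
  "block_subfms b (Rel R ts) = {}"
| "block_subfms b (Eq t u) = {}"
| "block_subfms b (Neg \<phi>) = block_subfms False \<phi>"
| "block_subfms b (And \<phi> \<psi>) = block_subfms False \<phi> \<union> block_subfms False \<psi>"
| "block_subfms b (Or \<phi> \<psi>) = block_subfms False \<phi> \<union> block_subfms False \<psi>"
| "block_subfms b (Imp \<phi> \<psi>) = block_subfms False \<phi> \<union> block_subfms False \<psi>"
| "block_subfms b (Iff \<phi> \<psi>) = block_subfms False \<phi> \<union> block_subfms False \<psi>"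
| "block_subfms b (Ex x \<phi>) = (if b then {} else {Ex x \<phi>}) \<union> block_subfms True \<phi>"
| "block_subfms b (All x \<phi>) = (if b then {} else {All x \<phi>}) \<union> block_subfms True \<phi>"

text \<open>The fresh symbol for a subformula \<open>\<chi>\<close> is \<open>Inr \<chi>\<close>; the original symbols become \<open>Inl R\<close>.\<close>

definition nf_sig :: "('r \<Rightarrow> nat) \<Rightarrow> ('r, 'c) fm \<Rightarrow> ('r + ('r, 'c) fm, 'c) sig" where
  "nf_sig ar \<phi> =
     \<lparr>rels = Inl ` rels (induced_sig ar \<phi>) \<union> Inr ` {\<chi> \<in> block_subfms False \<phi>. fv \<chi> \<noteq> {}},
      arity = case_sum (arity (induced_sig ar \<phi>)) (\<lambda>\<chi>. card (fv \<chi>)),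
      cons = cons (induced_sig ar \<phi>)\<rparr>"


section \<open>Types\<close>

definition rel_atoms :: "nat \<Rightarrow> ('r, 'c) sig \<Rightarrow> ('r, 'c) fm set" where
  "rel_atoms k \<sigma> = {Rel R ts | R ts. R \<in> rels \<sigma> \<and> length ts = arity \<sigma> R \<and>
     set ts \<subseteq> Var ` {1..k} \<union> Const ` cons \<sigma>}"

definition Lit :: "nat \<Rightarrow> ('r, 'c) sig \<Rightarrow> ('r, 'c) fm set" where
  "Lit k \<sigma> = rel_atoms k \<sigma> \<union> Neg ` rel_atoms k \<sigma>"

definition ktypes :: "nat \<Rightarrow> ('r, 'c) sig \<Rightarrow> ('r, 'c) fm set set" where
  "ktypes k \<sigma> = {T. T \<subseteq> Lit k \<sigma> \<and> (\<forall>\<alpha>\<in>rel_atoms k \<sigma>. (\<alpha> \<in> T) \<noteq> (Neg \<alpha> \<in> T))}"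

lemma card_ktypes:
  assumes "signature \<sigma>"
  shows "card (ktypes k \<sigma>) = (\<Prod>R\<in>rels \<sigma>. 2 ^ ((k + card (cons \<sigma>)) ^ arity \<sigma> R))"
proof -
  let ?V = "Var ` {1..k} \<union> Const ` cons \<sigma>"
  let ?L = "\<lambda>R. {ts. set ts \<subseteq> ?V \<and> length ts = arity \<sigma> R}"
  have fin: "finite (rels \<sigma>)" "finite (cons \<sigma>)" using assms by (auto simp: signature_def)
  have finV: "finite ?V" using fin by simp
  have cV: "card ?V = k + card (cons \<sigma>)"
    using fin by (subst card_Un_disjoint) (auto simp: card_image inj_on_def)
  have A: "rel_atoms k \<sigma> = (\<lambda>(R, ts). Rel R ts) ` (SIGMA R:rels \<sigma>. ?L R)"
    by (auto simp: rel_atoms_def)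
  have inj: "inj_on (\<lambda>(R, ts). Rel R ts) (SIGMA R:rels \<sigma>. ?L R)"
    by (auto simp: inj_on_def)
  have finA: "finite (rel_atoms k \<sigma>)"
    unfolding A using fin finV by (intro finite_imageI finite_SigmaI finite_lists_length_eq)
  have cA: "card (rel_atoms k \<sigma>) = (\<Sum>R\<in>rels \<sigma>. (k + card (cons \<sigma>)) ^ arity \<sigma> R)"
    unfolding A card_image[OF inj] using fin finV
    by (subst card_SigmaI) (auto simp: card_lists_length_eq finite_lists_length_eq cV[simplified])
  have notneg: "Neg \<beta> \<notin> rel_atoms k \<sigma>" for \<beta> by (auto simp: rel_atoms_def)
  have "bij_betw (\<lambda>S. S \<union> Neg ` (rel_atoms k \<sigma> - S)) (Pow (rel_atoms k \<sigma>)) (ktypes k \<sigma>)"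
    by (rule bij_betw_byWitness[where f' = "\<lambda>T. T \<inter> rel_atoms k \<sigma>"])
       (use notneg in \<open>auto simp: ktypes_def Lit_def\<close>)
  then have "card (ktypes k \<sigma>) = 2 ^ card (rel_atoms k \<sigma>)"
    using bij_betw_same_card card_Pow[OF finA] by metis
  then show ?thesis by (simp add: cA power_sum)
qed


section \<open>Adequacy of satisfiability over the natural numbers\<close>

instance tm :: (countable) countable by countable_datatype
instance fm :: (countable, countable) countable by countable_datatype

lemma finite_fv: "finite (fv \<phi>)"
proof -
  have "finite (tm_vars t)" for t :: "'b tm" by (cases t) auto
  then show ?thesis by (induction \<phi>) auto
qed

lemma sat_cong: "(\<And>x. x \<in> fv \<phi> \<Longrightarrow> s x = s' x) \<Longrightarrow> sat M s \<phi> = sat M s' \<phi>"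
proof (induction \<phi> arbitrary: s s')
  case (Rel R ts)
  have "tm_val M s t = tm_val M s' t" if "t \<in> set ts" for t
    using Rel that by (cases t) force+
  then have "map (tm_val M s) ts = map (tm_val M s') ts" by simp
  then show ?case by (simp only: sat.simps)
next
  case (Eq t u)
  have "tm_val M s t = tm_val M s' t" "tm_val M s u = tm_val M s' u"
    using Eq by (cases t; cases u; force)+
  then show ?case by simp
next
  case (Ex x \<phi>)
  have "sat M (s(x := a)) \<phi> = sat M (s'(x := a)) \<phi>" for a by (rule Ex.IH) (use Ex.prems in auto)
  then show ?case by simp
next
  case (All x \<phi>)
  have "sat M (s(x := a)) \<phi> = sat M (s'(x := a)) \<phi>" for a by (rule All.IH) (use All.prems in auto)
  then show ?case by simp
next
  case (Neg \<phi>) then show ?case by (metis fv.simps(3) sat.simps(3))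
next
  case (And \<phi> \<psi>) then show ?case by (metis UnCI fv.simps(4) sat.simps(4))
next
  case (Or \<phi> \<psi>) then show ?case by (metis UnCI fv.simps(5) sat.simps(5))
next
  case (Imp \<phi> \<psi>) then show ?case by (metis UnCI fv.simps(6) sat.simps(6))
next
  case (Iff \<phi> \<psi>) then show ?case by (metis UnCI fv.simps(7) sat.simps(7))
qed

datatype ('r, 'c) sktm = SkBase | SkConst 'c | SkWit nat "('r, 'c) fm" "('r, 'c) sktm list"

instance sktm :: (countable, countable) countable by countable_datatype

definition env :: "'a \<Rightarrow> 'a list \<Rightarrow> nat \<Rightarrow> 'a" where
  "env d as i = (if i < length as then as ! i else d)"

definition wit :: "('r, 'c, 'a) struct \<Rightarrow> 'a \<Rightarrow> nat \<Rightarrow> ('r, 'c) fm \<Rightarrow> 'a list \<Rightarrow> 'a" where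
  "wit M d x \<phi> as = (if \<exists>a\<in>domain M. sat M ((env d as)(x := a)) \<phi>
     then SOME a. a \<in> domain M \<and> sat M ((env d as)(x := a)) \<phi> else d)"

primrec sk_val :: "('r, 'c, 'a) struct \<Rightarrow> 'a \<Rightarrow> ('r, 'c) sktm \<Rightarrow> 'a" where
  "sk_val M d SkBase = d"
| "sk_val M d (SkConst c) = const_int M c"
| "sk_val M d (SkWit x \<phi> ts) = wit M d x \<phi> (map (sk_val M d) ts)"

lemma wit_in: "d \<in> domain M \<Longrightarrow> wit M d x \<phi> as \<in> domain M"
  unfolding wit_def by (auto intro: someI2)

lemma wit_sat:
  assumes "a \<in> domain M" "sat M ((env d as)(x := a)) \<phi>"
  shows "sat M ((env d as)(x := wit M d x \<phi> as)) \<phi>"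
proof -
  have ex: "\<exists>a. a \<in> domain M \<and> sat M ((env d as)(x := a)) \<phi>" using assms by blast
  then have eq: "wit M d x \<phi> as = (SOME a. a \<in> domain M \<and> sat M ((env d as)(x := a)) \<phi>)"
    unfolding wit_def by (simp add: Bex_def)
  show ?thesis unfolding eq using someI_ex[OF ex] by blast
qed

theorem model_imp_satisfiable:
  fixes \<phi> :: "('r :: countable, 'c :: countable) fm" and M :: "('r, 'c, 'a) struct"
  assumes "is_model ar M \<phi>"
  shows "satisfiable ar \<phi>"
proof -
  have M: "is_struct ar M" and Msat: "\<And>s. range s \<subseteq> domain M \<Longrightarrow> sat M s \<phi>"
    using assms by (auto simp: is_model_def)
  obtain d where d: "d \<in> domain M" using M by (auto simp: is_struct_def)
  define K where "K = range (sk_val M d)"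
  have dK: "d \<in> K" unfolding K_def by (rule range_eqI[of _ _ SkBase]) simp
  have cK: "const_int M c \<in> K" for c unfolding K_def by (rule range_eqI[of _ _ "SkConst c"]) simp
  have "sk_val M d t \<in> domain M" for t
    using M d by (cases t) (auto simp: is_struct_def wit_in)
  then have KM: "K \<subseteq> domain M" by (auto simp: K_def)
  have witK: "wit M d x \<psi> as \<in> K" if "set as \<subseteq> K" for x \<psi> as
  proof -
    have "as \<in> lists (range (sk_val M d))" using that by (auto simp: K_def)
    then obtain ts where "as = map (sk_val M d) ts" by (metis lists_image imageE)
    then show ?thesis unfolding K_def by (intro range_eqI[of _ _ "SkWit x \<psi> ts"]) simp
  qed
  have TV: "\<exists>a\<in>K. sat M (s(x := a)) \<psi>"
    if s: "range s \<subseteq> K" and a: "a \<in> domain M" "sat M (s(x := a)) \<psi>" for s x a \<psi>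
  proof -
    obtain n where n: "\<And>y. y \<in> fv \<psi> \<Longrightarrow> y < n"
      using finite_fv[of \<psi>] by (meson finite_nat_set_iff_bounded)
    define as where "as = map s [0..<n]"
    have ag: "((env d as)(x := b)) y = (s(x := b)) y" if "y \<in> fv \<psi>" for y b
      using n[OF that] by (auto simp: env_def as_def)
    have eq: "sat M ((env d as)(x := b)) \<psi> = sat M (s(x := b)) \<psi>" for b
      by (rule sat_cong) (rule ag)
    have "sat M (s(x := wit M d x \<psi> as)) \<psi>" using wit_sat[of a M d as x \<psi>] a eq by simp
    moreover have "set as \<subseteq> K" using s by (auto simp: as_def)
    ultimately show ?thesis using witK by blast
  qed
  have "countable K" unfolding K_def by simp
  then obtain h :: "'a \<Rightarrow> nat" where h: "inj_on h K" by (auto simp: countable_def)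
  define N :: "('r, 'c, nat) struct" where
    "N = \<lparr>domain = h ` K, rel_int = \<lambda>R. map h ` {as \<in> rel_int M R. set as \<subseteq> K},
          const_int = \<lambda>c. h (const_int M c)\<rparr>"
  have relN: "rel_int N R = map h ` {as \<in> rel_int M R. set as \<subseteq> K}" for R
    by (simp add: N_def)
  have N: "is_struct ar N"
    unfolding is_struct_def
  proof (intro conjI allI subsetI)
    fix R bs assume "bs \<in> rel_int N R"
    then obtain as where as: "as \<in> rel_int M R" "set as \<subseteq> K" "bs = map h as"
      by (auto simp: N_def)
    have "length as = ar R" using M as(1) unfolding is_struct_def by blast
    then show "bs \<in> {as. length as = ar R \<and> set as \<subseteq> domain N}"
      using as by (auto simp: N_def)
  qed (use dK cK in \<open>auto simp: N_def\<close>)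
  have tv: "tm_val N (h \<circ> s) t = h (tm_val M s t)" for s t by (cases t) (auto simp: N_def)
  have tvK: "tm_val M s t \<in> K" if "range s \<subseteq> K" for s t using that cK by (cases t) auto
  have upd: "(h \<circ> s)(x := h a) = h \<circ> (s(x := a))" for s x a by auto
  have main: "sat N (h \<circ> s) \<psi> = sat M s \<psi>" if "range s \<subseteq> K" for s \<psi>
    using that
  proof (induction \<psi> arbitrary: s)
    case (Rel R ts)
    let ?as = "map (tm_val M s) ts"
    have K: "set ?as \<subseteq> K" using tvK[OF Rel] by auto
    have eq: "map (tm_val N (h \<circ> s)) ts = map h ?as" by (simp add: tv)
    have inj: "as = ?as" if "set as \<subseteq> K" "map h as = map h ?as" for as
      by (rule map_inj_on[OF that(2)]) (rule inj_on_subset[OF h], use that(1) K in blast)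
    have "map h ?as \<in> rel_int N R \<longleftrightarrow> ?as \<in> rel_int M R"
    proof
      assume "map h ?as \<in> rel_int N R"
      then obtain as where as: "map h ?as = map h as" "as \<in> {as \<in> rel_int M R. set as \<subseteq> K}"
        unfolding relN by (rule imageE)
      have "as = ?as" by (rule inj) (use as in \<open>blast, simp only: as(1)\<close>)
      then show "?as \<in> rel_int M R" using as(2) by blast
    next
      assume "?as \<in> rel_int M R"
      then show "map h ?as \<in> rel_int N R" unfolding relN by (intro imageI CollectI conjI K)
    qed
    then show ?case by (simp only: sat.simps eq)
  next
    case (Eq t u)
    show ?case unfolding sat.simps tv by (rule inj_on_eq_iff[OF h tvK[OF Eq] tvK[OF Eq]])
  next
    case (Ex x \<psi>)
    have IH: "sat N ((h \<circ> s)(x := h a)) \<psi> = sat M (s(x := a)) \<psi>" if "a \<in> K" for a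
      unfolding upd by (rule Ex.IH) (use Ex.prems that in auto)
    have "sat N (h \<circ> s) (Ex x \<psi>) \<longleftrightarrow> (\<exists>a\<in>K. sat M (s(x := a)) \<psi>)"
      using IH by (auto simp: N_def)
    also have "\<dots> \<longleftrightarrow> sat M s (Ex x \<psi>)" using TV[OF Ex.prems] KM by auto
    finally show ?case .
  next
    case (All x \<psi>)
    have IH: "sat N ((h \<circ> s)(x := h a)) \<psi> = sat M (s(x := a)) \<psi>" if "a \<in> K" for a
      unfolding upd by (rule All.IH) (use All.prems that in auto)
    have "sat N (h \<circ> s) (All x \<psi>) \<longleftrightarrow> (\<forall>a\<in>K. sat M (s(x := a)) \<psi>)"
      using IH by (auto simp: N_def)
    also have "\<dots> \<longleftrightarrow> sat M s (All x \<psi>)"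
      using TV[OF All.prems, of _ x "Neg \<psi>"] KM by auto
    finally show ?case .
  qed simp_all
  have "sat N s \<phi>" if s: "range s \<subseteq> domain N" for s
  proof -
    have "\<forall>x. \<exists>a\<in>K. s x = h a" using s by (auto simp: N_def)
    then obtain s' where s': "\<And>x. s' x \<in> K \<and> s x = h (s' x)" by metis
    then have "s = h \<circ> s'" "range s' \<subseteq> K" by auto
    then show ?thesis using main[of s' \<phi>] Msat[of s'] KM by auto
  qed
  then have "is_model ar N \<phi>" using N by (simp add: is_model_def)
  then show ?thesis by (auto simp: satisfiable_def)
qed

end

theory Submission
  imports Defs
begin

text \<open>Let \<open>A\<close> be a model of \<open>\<phi>\<close>, expanded so that every fresh symbol of the normal-form signature
  holds exactly where its subformula does. Consider a uniformly random structure \<open>W\<close> on the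
  constants of \<open>A\<close> and \<open>N\<close> further elements. A fixed set of fewer than \<open>k\<close> elements and a fixed
  one-point extension of it involve at most \<open>Q\<close> new atoms, where \<open>Q\<close> is the number of atoms over
  \<open>k\<close> variables that contain the last one. Different candidates for the new point are independent,
  so by the union bound some \<open>W\<close> satisfies all extension axioms once \<open>N\<close> exceeds \<open>2 ^ Q\<close> by a
  polynomial factor. Remove from \<open>W\<close> all elements and all atoms whose type is not realised in
  \<open>A\<close>: the realised types that remain are closed under one-point extensions, as in \<open>A\<close>, which
  gives a guarded bisimulation with \<open>A\<close>, and hence a model of \<open>\<phi>\<close>. Finally, if \<open>L\<close> is the number
  of all atoms over \<open>k\<close> variables, then \<open>Q \<le> (1 - (1 - 1 / k) ^ k) L\<close>, and \<open>(1 - 1 / k) ^ k\<close>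
  tends to \<open>1 / e\<close>.\<close>

section \<open>Finite structures with extension axioms\<close>

text \<open>By the recursion \<open>eq\<close>, whose two summands grow with \<open>x\<close>; the
  induction runs over \<open>int\<close>, where differences do not truncate. It bounds the new atoms
  over a small set by those over a set of maximal size.\<close>

lemma power_Suc_diff_mono:
  fixes a b :: nat
  assumes "a \<le> b"
  shows "(a + 1) ^ r - a ^ r \<le> (b + 1) ^ r - b ^ r"
proof -
  have "int ((a + 1) ^ r) - int (a ^ r) \<le> int ((b + 1) ^ r) - int (b ^ r)"
  proof (induction r)
    case (Suc r)
    have eq: "int ((x + 1) ^ Suc r) - int (x ^ Suc r)
      = int x * (int ((x + 1) ^ r) - int (x ^ r)) + int ((x + 1) ^ r)" for x :: nat
      by (simp add: algebra_simps)
    have "int ((a + 1) ^ r) \<le> int ((b + 1) ^ r)"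
      using assms by (simp add: power_mono del: of_nat_power)
    moreover have "int a * (int ((a + 1) ^ r) - int (a ^ r)) \<le> int b * (int ((b + 1) ^ r) - int (b ^ r))"
      using assms Suc by (intro mult_mono) (auto simp: power_mono simp del: of_nat_power)
    ultimately show ?case unfolding eq by linarith
  qed simp
  moreover have "a ^ r \<le> (a + 1) ^ r" "b ^ r \<le> (b + 1) ^ r" by (simp_all add: power_mono)
  ultimately show ?thesis by linarith
qed

text \<open>Divided by \<open>2 ^ card X\<close>, this is independence in counting form: a uniformly
  random subset of \<open>X\<close> has trace \<open>P i\<close> on \<open>A i\<close> with
  probability at least \<open>1 / 2 ^ Q\<close>, and traces on disjoint sets are independent. The
  induction splits \<open>W\<close> into \<open>W \<inter> A i\<close> and
  \<open>W - A i\<close>.\<close>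

lemma card_avoiding_traces_le:
  fixes A P :: "'i \<Rightarrow> 'x set"
  assumes "finite I" "finite X" "\<And>i. i \<in> I \<Longrightarrow> A i \<subseteq> X" "\<And>i. i \<in> I \<Longrightarrow> P i \<subseteq> A i"
    "\<And>i. i \<in> I \<Longrightarrow> card (A i) \<le> Q"
    "\<And>i j. i \<in> I \<Longrightarrow> j \<in> I \<Longrightarrow> i \<noteq> j \<Longrightarrow> A i \<inter> A j = {}"
  shows "real (card {W \<in> Pow X. \<forall>i\<in>I. W \<inter> A i \<noteq> P i}) \<le> 2 ^ card X * (1 - 1 / 2 ^ Q) ^ card I"
  using assms
proof (induction I arbitrary: X rule: finite_induct)
  case empty
  have "{W \<in> Pow X. \<forall>i\<in>{}. W \<inter> A i \<noteq> P i} = Pow X" by auto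
  then show ?case using empty.prems(1) by (simp add: card_Pow)
next
  case (insert i I)
  let ?B = "\<lambda>X I. {W \<in> Pow X. \<forall>i\<in>I. W \<inter> A i \<noteq> P i}"
  have Ai: "A i \<subseteq> X" "finite (A i)" "P i \<subseteq> A i" "card (A i) \<le> Q"
    using insert.prems(1-4) finite_subset[of "A i" X] by auto
  have disj: "A i \<inter> A j = {}" if "j \<in> I" for j
    using insert.prems(5)[of i j] insert.hyps(2) that by auto
  have IH: "real (card (?B (X - A i) I)) \<le> 2 ^ card (X - A i) * (1 - 1 / 2 ^ Q) ^ card I"
  proof (rule insert.IH)
    show "A j \<subseteq> X - A i" if "j \<in> I" for j using disj[OF that] insert.prems(2)[of j] that by blast
  qed (use insert.prems in auto)
  have "card (?B X (insert i I)) \<le> card ((Pow (A i) - {P i}) \<times> ?B (X - A i) I)"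
  proof (rule card_inj_on_le[where f = "\<lambda>W. (W \<inter> A i, W - A i)"])
    show "inj_on (\<lambda>W. (W \<inter> A i, W - A i)) (?B X (insert i I))" by (auto simp: inj_on_def)
    have "(W - A i) \<inter> A j = W \<inter> A j" if "j \<in> I" for W j using disj[OF that] by blast
    then show "(\<lambda>W. (W \<inter> A i, W - A i)) ` ?B X (insert i I) \<subseteq> (Pow (A i) - {P i}) \<times> ?B (X - A i) I"
      by auto
    show "finite ((Pow (A i) - {P i}) \<times> ?B (X - A i) I)" using Ai insert.prems(1) by simp
  qed
  also have "\<dots> = (2 ^ card (A i) - 1) * card (?B (X - A i) I)"
    using Ai by (simp add: card_cartesian_product card_Diff_singleton card_Pow)
  finally have "real (card (?B X (insert i I))) \<le> real ((2 ^ card (A i) - 1) * card (?B (X - A i) I))"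
    by (simp only: of_nat_le_iff)
  also have "\<dots> = (2 ^ card (A i) - 1) * real (card (?B (X - A i) I))"
    by (simp add: of_nat_diff)
  also have "\<dots> \<le> (2 ^ card (A i) * (1 - 1 / 2 ^ Q)) *
      (2 ^ card (X - A i) * (1 - 1 / 2 ^ Q) ^ card I)"
  proof (intro mult_mono IH)
    have "(2::real) ^ card (A i) \<le> 2 ^ Q" using Ai by (intro power_increasing) auto
    then show "(2::real) ^ card (A i) - 1 \<le> 2 ^ card (A i) * (1 - 1 / 2 ^ Q)"
      by (simp add: field_simps)
  qed auto
  also have "\<dots> = 2 ^ (card (A i) + card (X - A i)) * (1 - 1 / 2 ^ Q) ^ card (insert i I)"
    using insert.hyps by (simp add: power_add)
  also have "card (A i) + card (X - A i) = card X"
    using Ai insert.prems(1) by (simp add: card_Diff_subset card_mono)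
  finally show ?case .
qed

text \<open>The facts still undecided when \<open>u\<close> is added to a structure on
  \<open>Y\<close>. For distinct points outside \<open>Y\<close> these sets are disjoint, which is
  the source of independence.\<close>

definition new_atoms :: "'r set \<Rightarrow> ('r \<Rightarrow> nat) \<Rightarrow> 'a set \<Rightarrow> 'a \<Rightarrow> ('r \<times> 'a list) set" where
  "new_atoms Rs r Y u = {(R, as). R \<in> Rs \<and> length as = r R \<and> set as \<subseteq> insert u Y \<and> u \<in> set as}"

lemma
  assumes "finite Rs" "finite Y" "u \<notin> Y" "card Y \<le> m"
  shows finite_new_atoms: "finite (new_atoms Rs r Y u)"
    and card_new_atoms_le: "card (new_atoms Rs r Y u) \<le> (\<Sum>R\<in>Rs. (m + 1) ^ r R - m ^ r R)"
proof -
  let ?L = "\<lambda>Z n. {as. set as \<subseteq> Z \<and> length as = n}"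
  have eq: "new_atoms Rs r Y u = (SIGMA R:Rs. ?L (insert u Y) (r R) - ?L Y (r R))"
    using assms(3) by (auto simp: new_atoms_def)
  show "finite (new_atoms Rs r Y u)"
    unfolding eq using assms by (intro finite_SigmaI finite_Diff finite_lists_length_eq) auto
  have "card (?L (insert u Y) n - ?L Y n) = (card Y + 1) ^ n - card Y ^ n" for n
    using assms by (subst card_Diff_subset) (auto simp: finite_lists_length_eq card_lists_length_eq)
  then have "card (new_atoms Rs r Y u) = (\<Sum>R\<in>Rs. (card Y + 1) ^ r R - card Y ^ r R)"
    unfolding eq using assms by (subst card_SigmaI) (auto simp: finite_lists_length_eq)
  also have "\<dots> \<le> (\<Sum>R\<in>Rs. (m + 1) ^ r R - m ^ r R)"
    by (intro sum_mono power_Suc_diff_mono assms)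
  finally show "card (new_atoms Rs r Y u) \<le> (\<Sum>R\<in>Rs. (m + 1) ^ r R - m ^ r R)" .
qed

text \<open>A subset with fewer than \<open>k\<close> elements is coded by a list of length
  \<open>k\<close> over \<open>U\<close>, padded with \<open>None\<close>.\<close>

lemma card_small_subsets_le:
  assumes "finite U"
  shows "finite {S. S \<subseteq> U \<and> card S < k}" "card {S. S \<subseteq> U \<and> card S < k} \<le> (card U + 1) ^ k"
proof -
  let ?L = "{xs. set xs \<subseteq> insert None (Some ` U) \<and> length xs = k}"
  have fin: "finite ?L" using assms by (intro finite_lists_length_eq) simp
  have "{S. S \<subseteq> U \<and> card S < k} \<subseteq> (\<lambda>xs. {x. Some x \<in> set xs}) ` ?L"
  proof
    fix S assume "S \<in> {S. S \<subseteq> U \<and> card S < k}"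
    then have S: "S \<subseteq> U" "card S < k" by auto
    obtain xs where xs: "set xs = S" "distinct xs"
      using finite_distinct_list[OF finite_subset[OF S(1) assms]] by auto
    then have len: "length xs \<le> k" using S(2) distinct_card[of xs] by auto
    show "S \<in> (\<lambda>xs. {x. Some x \<in> set xs}) ` ?L"
      by (rule image_eqI[of _ _ "map Some xs @ replicate (k - length xs) None"])
        (use xs S len in auto)
  qed
  then show "finite {S. S \<subseteq> U \<and> card S < k}" "card {S. S \<subseteq> U \<and> card S < k} \<le> (card U + 1) ^ k"
    using fin finite_subset surj_card_le[OF fin] assms
    by (auto simp: card_lists_length_eq card_image card_insert_if)
qed

text \<open>The placeholder \<open>star\<close> stands for the new point, so that the pattern \<open>T\<close> to be realised
  does not depend on the candidate \<open>u\<close>.\<close>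

lemma exists_extension_structure:
  fixes Rs :: "'r set" and K U :: "'a set"
  assumes fin: "finite Rs" "finite K" "finite U"
    and disj: "K \<inter> U = {}" "star \<notin> K \<union> U"
    and c: "card K \<le> c" and k: "k \<ge> 1"
    and Q: "Q = (\<Sum>R\<in>Rs. (k + c) ^ r R - (k - 1 + c) ^ r R)"
    and small: "(real (card U) + 1) ^ k * 2 ^ Q * (1 - 1 / 2 ^ Q) ^ (card U + 1 - k) < 1"
  shows "\<exists>W. \<forall>S T. S \<subseteq> U \<longrightarrow> card S < k \<longrightarrow>
    (\<exists>u\<in>U - S. \<forall>R\<in>Rs. \<forall>as. length as = r R \<longrightarrow> set as \<subseteq> insert u (K \<union> S) \<longrightarrow> u \<in> set as \<longrightarrow>
       ((R, as) \<in> W \<longleftrightarrow> map (id(u := star)) as \<in> T R))"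
proof -
  define N where "N = (new_atoms Rs r :: 'a set \<Rightarrow> _)"
  define X where "X = (SIGMA R:Rs. {as. set as \<subseteq> K \<union> U \<and> length as = r R})"
  \<comment> \<open>Substitutes the candidate \<open>u\<close> for the placeholder, turning a
    pattern at \<open>star\<close> into facts about \<open>u\<close>.\<close>
  define move :: "'a \<Rightarrow> 'r \<times> 'a list \<Rightarrow> 'r \<times> 'a list" where
    "move u = map_prod id (map (id(star := u)))" for u :: 'a
  define Ss where "Ss = {S. S \<subseteq> U \<and> card S < k}"
  \<comment> \<open>The structures in which no candidate realises the pattern \<open>P\<close> over
    \<open>K \<union> S\<close>.\<close>
  define bad where "bad S P = {W \<in> Pow X. \<forall>u\<in>U - S. W \<inter> N (K \<union> S) u \<noteq> move u ` P}"
    for S P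
  define q :: real where "q = 1 - 1 / 2 ^ Q"
  have q: "0 \<le> q" "q \<le> 1" by (simp_all add: q_def)
  have finX: "finite X"
    unfolding X_def using fin by (intro finite_SigmaI finite_lists_length_eq) auto
  have N: "finite (N (K \<union> S) u)" "card (N (K \<union> S) u) \<le> Q"
    if "S \<in> Ss" "u \<notin> K \<union> S" for S u
  proof -
    have S: "finite S" "card S \<le> k - 1" using that fin finite_subset by (auto simp: Ss_def)
    then have "card (K \<union> S) \<le> k - 1 + c" using card_Un_le[of K S] c by linarith
    moreover have "k - 1 + c + 1 = k + c" using k by simp
    ultimately show "finite (N (K \<union> S) u)" "card (N (K \<union> S) u) \<le> Q"
      unfolding N_def Q using fin S that(2)
        finite_new_atoms[of Rs "K \<union> S" u] card_new_atoms_le[of Rs "K \<union> S" u "k - 1 + c" r] by auto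
  qed
  have move_N: "move u ` P \<subseteq> N (K \<union> S) u" if "P \<subseteq> N (K \<union> S) star" for u P S
    using that by (fastforce simp: move_def N_def new_atoms_def)
  have bad_le: "real (card (bad S P)) \<le> 2 ^ card X * q ^ (card U + 1 - k)"
    if S: "S \<in> Ss" and P: "P \<in> Pow (N (K \<union> S) star)" for S P
  proof -
    have "real (card (bad S P)) \<le> 2 ^ card X * q ^ card (U - S)"
      unfolding bad_def q_def
    proof (rule card_avoiding_traces_le)
      fix u assume u: "u \<in> U - S"
      show "N (K \<union> S) u \<subseteq> X" using u S by (auto simp: N_def new_atoms_def X_def Ss_def)
      show "move u ` P \<subseteq> N (K \<union> S) u" using move_N P by blast
      show "card (N (K \<union> S) u) \<le> Q" using N(2)[OF S, of u] u disj by blast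
      fix v assume "v \<in> U - S" "u \<noteq> v"
      then show "N (K \<union> S) u \<inter> N (K \<union> S) v = {}"
        using u disj by (auto simp: N_def new_atoms_def)
    qed (use fin finX in auto)
    also have "\<dots> \<le> 2 ^ card X * q ^ (card U + 1 - k)"
    proof (intro mult_left_mono power_decreasing)
      \<comment> \<open>\<open>S\<close> has at most \<open>k - 1\<close> elements, so at least
        \<open>card U + 1 - k\<close> candidates remain.\<close>
      have "card U - card S \<le> card (U - S)" by (rule diff_card_le_card_Diff)
          (use S fin finite_subset in \<open>auto simp: Ss_def\<close>)
      then show "card U + 1 - k \<le> card (U - S)" using S by (auto simp: Ss_def)
    qed (use q in auto)
    finally show ?thesis .
  qed
  let ?I = "SIGMA S:Ss. Pow (N (K \<union> S) star)"
  have starN: "finite (N (K \<union> S) star)" "card (N (K \<union> S) star) \<le> Q" if "S \<in> Ss" for S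
    using N[OF that, of star] that disj by (auto simp: Ss_def)
  have finSs: "finite Ss" unfolding Ss_def by (rule card_small_subsets_le(1)[OF fin(3)])
  then have finI: "finite ?I" using starN by (intro finite_SigmaI) auto
  \<comment> \<open>At most \<open>(card U + 1) ^ k\<close> sets \<open>S\<close>, and at most
    \<open>2 ^ Q\<close> patterns over each of them.\<close>
  have cardI: "real (card ?I) \<le> (real (card U) + 1) ^ k * 2 ^ Q"
  proof -
    have "card ?I = (\<Sum>S\<in>Ss. 2 ^ card (N (K \<union> S) star))"
      using finSs starN by (subst card_SigmaI) (auto simp: card_Pow)
    also have "\<dots> \<le> card Ss * 2 ^ Q"
      using sum_bounded_above[of Ss "\<lambda>S. 2 ^ card (N (K \<union> S) star)" "2 ^ Q :: nat"] starN
      by (simp add: power_increasing)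
    also have "\<dots> \<le> (card U + 1) ^ k * 2 ^ Q"
      using card_small_subsets_le(2)[OF fin(3)] unfolding Ss_def by (intro mult_right_mono) auto
    finally have "real (card ?I) \<le> real ((card U + 1) ^ k * 2 ^ Q)" by (simp only: of_nat_le_iff)
    then show ?thesis by (simp add: add.commute)
  qed
  have "real (card (\<Union>(S, P)\<in>?I. bad S P)) \<le> (\<Sum>(S, P)\<in>?I. real (card (bad S P)))"
    using card_UN_le[OF finI, of "\<lambda>(S, P). bad S P"]
    by (simp add: case_prod_unfold flip: of_nat_sum)
  also have "\<dots> \<le> (\<Sum>(S, P)\<in>?I. 2 ^ card X * q ^ (card U + 1 - k))"
    by (intro sum_mono) (use bad_le in auto)
  also have "\<dots> = real (card ?I) * (2 ^ card X * q ^ (card U + 1 - k))"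
    by (simp add: case_prod_unfold)
  also have "\<dots> \<le> ((real (card U) + 1) ^ k * 2 ^ Q) * (2 ^ card X * q ^ (card U + 1 - k))"
    using cardI q by (intro mult_right_mono) auto
  also have "\<dots> = 2 ^ card X * ((real (card U) + 1) ^ k * 2 ^ Q * q ^ (card U + 1 - k))"
    by simp
  also have "\<dots> < 2 ^ card X * 1"
    using small unfolding q_def by (intro mult_strict_left_mono) auto
  also have "\<dots> = real (card (Pow X))" using finX by (simp add: card_Pow)
  finally have less: "card (\<Union>(S, P)\<in>?I. bad S P) < card (Pow X)" by simp
  have "\<not> Pow X \<subseteq> (\<Union>(S, P)\<in>?I. bad S P)"
  proof
    assume "Pow X \<subseteq> (\<Union>(S, P)\<in>?I. bad S P)"
    moreover have "(\<Union>(S, P)\<in>?I. bad S P) \<subseteq> Pow X" by (auto simp: bad_def)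
    ultimately show False using less by (metis less_irrefl subset_antisym)
  qed
  then obtain W where W: "W \<in> Pow X" and
    good: "\<And>S P. S \<in> Ss \<Longrightarrow> P \<subseteq> N (K \<union> S) star \<Longrightarrow> W \<notin> bad S P" by blast
  show ?thesis
  proof (intro exI[of _ W] allI impI)
    fix S T assume S: "S \<subseteq> U" "card S < k"
    \<comment> \<open>Only the restriction of \<open>T\<close> to the new atoms matters, and this is
      one of the finitely many patterns counted in the union bound.\<close>
    define P where "P = {(R, as) \<in> N (K \<union> S) star. as \<in> T R}"
    have "W \<notin> bad S P" using S by (intro good) (auto simp: Ss_def P_def)
    then obtain u where u: "u \<in> U - S" and uW: "W \<inter> N (K \<union> S) u = move u ` P"
      using W by (auto simp: bad_def)
    have ustar: "u \<noteq> star" "u \<notin> K \<union> S" using u disj by auto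
    have "(R, as) \<in> W \<longleftrightarrow> map (id(u := star)) as \<in> T R"
      if R: "R \<in> Rs" and as: "length as = r R" "set as \<subseteq> insert u (K \<union> S)" "u \<in> set as" for R as
    proof -
      have "(R, as) \<in> W \<longleftrightarrow> (R, as) \<in> move u ` P"
        unfolding uW[symmetric] using R as by (auto simp: N_def new_atoms_def)
      also have "\<dots> \<longleftrightarrow> map (id(u := star)) as \<in> T R"
      proof
        assume "(R, as) \<in> move u ` P"
        then obtain bs where bs: "as = map (id(star := u)) bs" "(R, bs) \<in> P"
          by (auto simp: move_def)
        have "map (id(u := star)) as = bs"
          unfolding bs(1) map_map using bs(2) ustar
          by (intro map_idI) (auto simp: P_def N_def new_atoms_def)
        then show "map (id(u := star)) as \<in> T R" using bs(2) by (simp add: P_def)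
      next
        assume T: "map (id(u := star)) as \<in> T R"
        have "map (id(star := u)) (map (id(u := star)) as) = as"
          unfolding map_map using as(2) ustar disj(2) S(1) by (intro map_idI) auto
        moreover have "(R, map (id(u := star)) as) \<in> P"
          using T R as by (force simp: P_def N_def new_atoms_def)
        ultimately show "(R, as) \<in> move u ` P"
          by (intro image_eqI[of _ _ "(R, map (id(u := star)) as)"]) (auto simp: move_def)
      qed
      finally show ?thesis .
    qed
    then show "\<exists>u\<in>U - S. \<forall>R\<in>Rs. \<forall>as. length as = r R \<longrightarrow> set as \<subseteq> insert u (K \<union> S) \<longrightarrow> u \<in> set as \<longrightarrow>
       ((R, as) \<in> W \<longleftrightarrow> map (id(u := star)) as \<in> T R)"
      using u by blast
  qed
qed

section \<open>The guarded cover of a model\<close>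

text \<open>Treats a whole block as one reassignment. A variable may be repeated in
  \<open>xs\<close>; its innermost occurrence then decides the value, so only the final assignment
  counts.\<close>

lemma sat_foldr_Ex:
  "sat M s (foldr Ex xs \<theta>) \<longleftrightarrow>
    (\<exists>s'. (\<forall>x. x \<notin> set xs \<longrightarrow> s' x = s x) \<and> s' ` set xs \<subseteq> domain M \<and> sat M s' \<theta>)"
proof (induction xs arbitrary: s)
  case Nil
  have "s' = s" if "\<forall>x. s' x = s x" for s' using that by auto
  then show ?case by auto
next
  case (Cons x xs)
  show ?case
  proof
    assume "sat M s (foldr Ex (x # xs) \<theta>)"
    then obtain a where a: "a \<in> domain M" "sat M (s(x := a)) (foldr Ex xs \<theta>)" by auto
    then obtain s' where s': "\<And>y. y \<notin> set xs \<Longrightarrow> s' y = (s(x := a)) y" "s' ` set xs \<subseteq> domain M"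
      "sat M s' \<theta>"
      unfolding Cons.IH by blast
    have "s' x \<in> domain M" using s'(1)[of x] s'(2) a by (cases "x \<in> set xs") auto
    then show "\<exists>s'. (\<forall>y. y \<notin> set (x # xs) \<longrightarrow> s' y = s y) \<and> s' ` set (x # xs) \<subseteq> domain M \<and> sat M s' \<theta>"
      using s' by (intro exI[of _ s']) auto
  next
    assume "\<exists>s'. (\<forall>y. y \<notin> set (x # xs) \<longrightarrow> s' y = s y) \<and> s' ` set (x # xs) \<subseteq> domain M \<and> sat M s' \<theta>"
    then obtain s' where s': "\<And>y. y \<notin> set (x # xs) \<Longrightarrow> s' y = s y" "s' ` set (x # xs) \<subseteq> domain M"
      "sat M s' \<theta>" by blast
    have "sat M (s(x := s' x)) (foldr Ex xs \<theta>)"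
      unfolding Cons.IH using s' by (intro exI[of _ s']) auto
    then show "sat M s (foldr Ex (x # xs) \<theta>)" using s'(2) by auto
  qed
qed

text \<open>Lets universal blocks be handled as negated existential blocks with the same
  guard.\<close>

lemma sat_foldr_All_iff: "sat M s (foldr All xs (Imp \<gamma> \<psi>)) \<longleftrightarrow> \<not> sat M s (foldr Ex xs (And \<gamma> (Neg \<psi>)))"
  by (induction xs arbitrary: s) auto

lemma fv_foldr [simp]:
  "fv (foldr Ex xs \<theta>) = fv \<theta> - set xs" "fv (foldr All xs \<theta>) = fv \<theta> - set xs"
  by (induction xs) auto

lemma syms_foldr [simp]:
  "rsyms (foldr Ex xs \<theta>) = rsyms \<theta>" "rsyms (foldr All xs \<theta>) = rsyms \<theta>"
  "csyms (foldr Ex xs \<theta>) = csyms \<theta>" "csyms (foldr All xs \<theta>) = csyms \<theta>"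
  by (induction xs) auto

text \<open>The body sits below a Boolean connective, which resets the flag, so its blocks are
  blocks of the whole formula.\<close>

lemma block_subfms_guarded:
  "block_subfms False \<psi> \<subseteq> block_subfms b (foldr Ex xs (And \<gamma> \<psi>))"
  "block_subfms False \<psi> \<subseteq> block_subfms b (foldr All xs (Imp \<gamma> \<psi>))"
  by (induction xs arbitrary: b) auto

lemma foldr_in_block_subfms:
  assumes "xs \<noteq> []"
  shows "foldr Ex xs \<theta> \<in> block_subfms False (foldr Ex xs \<theta>)"
    and "foldr All xs \<theta> \<in> block_subfms False (foldr All xs \<theta>)"
  using assms by (cases xs; simp)+

section \<open>Expansion by the fresh symbols\<close>

text \<open>The increasing enumeration of the free variables fixes the argument positions of
  \<open>Inr \<chi>\<close>.\<close>

definition nf_int :: "('r, 'c, 'a) struct \<Rightarrow> 'r + ('r, 'c) fm \<Rightarrow> 'a list set" where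
  "nf_int A = case_sum (rel_int A) (\<lambda>\<chi>. {map s (sorted_list_of_set (fv \<chi>)) | s. sat A s \<chi>})"

lemma nf_int_Inl [simp]: "nf_int A (Inl R) = rel_int A R"
  by (simp add: nf_int_def)

text \<open>Assignments that yield the same tuple agree on the free variables, and truth depends on
  nothing else.\<close>

lemma map_in_nf_int_Inr: "map s (sorted_list_of_set (fv \<chi>)) \<in> nf_int A (Inr \<chi>) \<longleftrightarrow> sat A s \<chi>"
proof
  assume "map s (sorted_list_of_set (fv \<chi>)) \<in> nf_int A (Inr \<chi>)"
  then obtain s' where s': "map s (sorted_list_of_set (fv \<chi>)) = map s' (sorted_list_of_set (fv \<chi>))"
    "sat A s' \<chi>"
    by (auto simp: nf_int_def)
  have "s x = s' x" if "x \<in> fv \<chi>" for x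
    using s'(1) that finite_fv[of \<chi>] by simp
  then show "sat A s \<chi>" using s'(2) sat_cong[of \<chi> s s'] by blast
qed (auto simp: nf_int_def)

text \<open>Isolates what is used of the random structure: it agrees with the expansion of
  \<open>A\<close> on the constants and satisfies the extension axioms. The elements of
  \<open>K\<close> are literally those of \<open>A\<close>, so embeddings can fix them.\<close>

locale generic_cover =
  fixes ar :: "'r \<Rightarrow> nat" and \<phi> :: "('r, 'c) fm" and A :: "('r, 'c, 'a) struct"
    and K U :: "'a set" and W :: "(('r + ('r, 'c) fm) \<times> 'a list) set"
    and star :: 'a and k :: nat and Rs :: "('r + ('r, 'c) fm) set" and r
  assumes A: "is_struct ar A"
    and Rs: "Rs = rels (nf_sig ar \<phi>)"
    and r: "r = arity (nf_sig ar \<phi>)"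
    and K: "K = const_int A ` csyms \<phi>"
    and KU: "K \<inter> U = {}" and star: "star \<notin> K \<union> U"
    and k: "\<And>R. R \<in> Rs \<Longrightarrow> r R \<le> k" "k \<ge> 2"
    and W_K: "\<And>R as. R \<in> Rs \<Longrightarrow> length as = r R \<Longrightarrow> set as \<subseteq> K \<Longrightarrow> (R, as) \<in> W \<longleftrightarrow> as \<in> nf_int A R"
    and ext: "\<And>S T. S \<subseteq> U \<Longrightarrow> card S < k \<Longrightarrow>
      \<exists>u\<in>U - S. \<forall>R\<in>Rs. \<forall>as. length as = r R \<longrightarrow> set as \<subseteq> insert u (K \<union> S) \<longrightarrow> u \<in> set as \<longrightarrow>
        ((R, as) \<in> W \<longleftrightarrow> map (id(u := star)) as \<in> T R)"
begin

section \<open>Embeddings and the cover\<close>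

text \<open>An isomorphism, fixing the constants, from the part of \<open>W\<close> on
  \<open>Z\<close> to an induced substructure of the expanded \<open>A\<close>: a witness that the
  type of \<open>Z\<close> is realised. Injectivity takes care of equality, which types do not
  record.\<close>

definition embeds :: "'a set \<Rightarrow> ('a \<Rightarrow> 'a) \<Rightarrow> bool" where
  "embeds Z f \<longleftrightarrow> K \<subseteq> Z \<and> Z \<subseteq> K \<union> U \<and> f ` Z \<subseteq> domain A \<and> inj_on f Z \<and> (\<forall>a\<in>K. f a = a) \<and>
     (\<forall>R\<in>Rs. \<forall>as. length as = r R \<longrightarrow> set as \<subseteq> Z \<longrightarrow> ((R, as) \<in> W \<longleftrightarrow> map f as \<in> nf_int A R))"

definition good :: "'a set \<Rightarrow> bool" where
  "good Y \<longleftrightarrow> (\<exists>f. embeds (K \<union> Y) f)"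

definition cover_domain :: "'a set" where
  "cover_domain = {a \<in> K \<union> U. good {a}}"

definition cover :: "('r, 'c, 'a) struct" where
  "cover = \<lparr>domain = cover_domain,
     rel_int = \<lambda>R. if R \<in> rsyms \<phi> then {as. length as = ar R \<and> good (set as) \<and> (Inl R, as) \<in> W} else {},
     const_int = \<lambda>c. if c \<in> csyms \<phi> then const_int A c else SOME a. a \<in> cover_domain\<rparr>"

lemma embeds_subset: "embeds Z f \<Longrightarrow> K \<subseteq> Z' \<Longrightarrow> Z' \<subseteq> Z \<Longrightarrow> embeds Z' f"
  unfolding embeds_def by (blast intro: inj_on_subset)

lemma embeds_imp_good: "embeds Z f \<Longrightarrow> Y \<subseteq> Z \<Longrightarrow> good Y"
  unfolding good_def using embeds_subset[of Z f "K \<union> Y"] by (meson Un_least Un_upper1 embeds_def)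

lemma embeds_domain: "embeds Z f \<Longrightarrow> Z \<subseteq> domain cover"
  using embeds_imp_good[of Z f] by (auto simp: cover_def cover_domain_def embeds_def)

lemma const_in_K: "c \<in> csyms \<phi> \<Longrightarrow> const_int A c \<in> K"
  by (simp add: K)

lemma embeds_K: "embeds K id"
proof -
  have "K \<subseteq> domain A" using A unfolding K by (auto simp: is_struct_def)
  then show ?thesis using W_K by (auto simp: embeds_def)
qed

lemma K_subset_domain: "K \<subseteq> domain cover"
  using embeds_domain[OF embeds_K] .

lemma Inl_Rs: "Inl R \<in> Rs \<longleftrightarrow> R \<in> rsyms \<phi>" "r (Inl R) = ar R"
  by (auto simp: Rs r nf_sig_def induced_sig_def)

text \<open>Every subset of an embedded set is realised, so the cover has lost no fact of
  \<open>W\<close> over \<open>Z\<close>.\<close>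

lemma rel_int_cover_iff:
  assumes "embeds Z f" "R \<in> rsyms \<phi>" "length as = ar R" "set as \<subseteq> Z"
  shows "as \<in> rel_int cover R \<longleftrightarrow> map f as \<in> rel_int A R"
proof -
  have "as \<in> rel_int cover R \<longleftrightarrow> (Inl R, as) \<in> W"
    using assms embeds_imp_good by (auto simp: cover_def)
  also have "\<dots> \<longleftrightarrow> map f as \<in> nf_int A (Inl R)"
    using assms Inl_Rs[of R] unfolding embeds_def by metis
  finally show ?thesis by simp
qed

section \<open>Extending embeddings\<close>

text \<open>The extension axiom for \<open>Z - K\<close> is applied to the pattern that
  \<open>a\<close> forms over the image of \<open>Z\<close>, pulled back along \<open>f\<close>.
  Facts about \<open>u\<close> then agree by the choice of \<open>u\<close>, all others because
  \<open>f\<close> is an embedding; that \<open>a\<close> is not yet a value of \<open>f\<close>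
  keeps the map injective.\<close>

lemma embeds_extend:
  assumes embeds: "embeds Z f" and fin: "finite (Z - K)" "card (Z - K) < k"
    and a: "a \<in> domain A" "a \<notin> f ` Z"
  shows "\<exists>u. u \<notin> Z \<and> embeds (insert u Z) (f(u := a))"
proof -
  have Z: "K \<subseteq> Z" "Z \<subseteq> K \<union> U" "\<And>b. b \<in> K \<Longrightarrow> f b = b"
    and agree: "\<And>R as. R \<in> Rs \<Longrightarrow> length as = r R \<Longrightarrow> set as \<subseteq> Z \<Longrightarrow>
      (R, as) \<in> W \<longleftrightarrow> map f as \<in> nf_int A R"
    using embeds by (auto simp: embeds_def)
  have KZ: "K \<union> (Z - K) = Z" using Z by auto
  have "Z - K \<subseteq> U" using Z by auto
  from ext[OF this fin(2), of "\<lambda>R. {bs. map (f(star := a)) bs \<in> nf_int A R}"]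
  obtain u where u: "u \<in> U - (Z - K)"
    and uW: "\<And>R as. R \<in> Rs \<Longrightarrow> length as = r R \<Longrightarrow> set as \<subseteq> insert u Z \<Longrightarrow> u \<in> set as \<Longrightarrow>
      (R, as) \<in> W \<longleftrightarrow> map (f(star := a)) (map (id(u := star)) as) \<in> nf_int A R"
    unfolding KZ mem_Collect_eq by blast
  have uZ: "u \<notin> Z" using u Z KU by auto
  have "(R, as) \<in> W \<longleftrightarrow> map (f(u := a)) as \<in> nf_int A R"
    if R: "R \<in> Rs" "length as = r R" "set as \<subseteq> insert u Z" for R as
  proof (cases "u \<in> set as")
    case True
    have "map (f(star := a)) (map (id(u := star)) as) = map (f(u := a)) as"
      unfolding map_map using R(3) star Z by (intro map_cong) auto
    then show ?thesis using uW[OF R True] by (simp only:)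
  next
    case False
    then have "map (f(u := a)) as = map f as" by (intro map_cong) auto
    then show ?thesis using agree[OF R(1,2)] False R(3) by auto
  qed
  moreover have "inj_on (f(u := a)) (insert u Z)"
    using embeds uZ a by (auto simp: embeds_def inj_on_def)
  ultimately have "embeds (insert u Z) (f(u := a))"
    using embeds u uZ a unfolding embeds_def by auto
  then show ?thesis using uZ by blast
qed

text \<open>The step of the guarded bisimulation from \<open>A\<close> to the cover: the values
  \<open>s' x\<close> of the variables outside \<open>V0\<close> are matched one variable at a
  time.\<close>

lemma embeds_extend_assignment:
  assumes fin: "finite V" and sub: "V0 \<subseteq> V" and card: "card V \<le> k"
    and embeds: "embeds (K \<union> s ` V0) f" and s': "\<And>x. x \<in> V0 \<Longrightarrow> f (s x) = s' x" "s' ` V \<subseteq> domain A"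
  shows "\<exists>g h. (\<forall>x\<in>V0. g x = s x) \<and> embeds (K \<union> g ` V) h \<and> (\<forall>x\<in>V. h (g x) = s' x)"
proof -
  have "\<exists>g h. (\<forall>x\<in>V0. g x = s x) \<and> embeds (K \<union> g ` (V0 \<union> D)) h \<and> (\<forall>x\<in>V0 \<union> D. h (g x) = s' x)"
    if "finite D" "D \<subseteq> V - V0" for D
    using that
  proof (induction D rule: finite_induct)
    case empty
    then show ?case using embeds s'(1) by auto
  next
    case (insert x D)
    then obtain g h where gh: "\<And>x. x \<in> V0 \<Longrightarrow> g x = s x" "embeds (K \<union> g ` (V0 \<union> D)) h"
      "\<And>x. x \<in> V0 \<union> D \<Longrightarrow> h (g x) = s' x" by blast
    let ?Z = "K \<union> g ` (V0 \<union> D)"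
    have x: "x \<notin> V0 \<union> D" "x \<in> V" using insert by auto
    have img: "g(x := b) ` (V0 \<union> insert x D) = insert b (g ` (V0 \<union> D))" for b using x by auto
    show ?case
    proof (cases "s' x \<in> h ` ?Z")
      \<comment> \<open>The value already has a preimage \<open>b\<close>; a new point with the same
        value would break injectivity.\<close>
      case True
      then obtain b where b: "b \<in> ?Z" "h b = s' x" by (metis imageE)
      have "K \<union> g(x := b) ` (V0 \<union> insert x D) = ?Z" unfolding img using b by auto
      then show ?thesis using gh b x by (intro exI[of _ "g(x := b)"] exI[of _ h]) auto
    next
      case False
      \<comment> \<open>\<open>V0 \<union> D\<close> still misses \<open>x\<close>, so fewer than
        \<open>k\<close> points outside \<open>K\<close> are in use and one more can be
        added.\<close>
      have VD: "finite (V0 \<union> D)" "V0 \<union> D \<subset> V"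
        using insert sub fin x finite_subset[of V0 V] by auto
      have "card (?Z - K) \<le> card (g ` (V0 \<union> D))" using VD by (intro card_mono) auto
      also have "\<dots> \<le> card (V0 \<union> D)" using VD card_image_le by blast
      also have "\<dots> < k" using psubset_card_mono[OF fin VD(2)] card by simp
      finally have "card (?Z - K) < k" .
      moreover have "finite (?Z - K)" using VD by (auto intro: finite_subset[of _ "g ` (V0 \<union> D)"])
      moreover have "s' x \<in> domain A" using x s'(2) by auto
      ultimately obtain u where u: "u \<notin> ?Z" "embeds (insert u ?Z) (h(u := s' x))"
        using embeds_extend[OF gh(2)] False by blast
      have "K \<union> g(x := u) ` (V0 \<union> insert x D) = insert u ?Z" unfolding img by auto
      moreover have "(h(u := s' x)) ((g(x := u)) y) = s' y" if "y \<in> V0 \<union> insert x D" for y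
      proof (cases "y = x")
        case False
        then have "y \<in> V0 \<union> D" using that by auto
        then show ?thesis using gh(3)[of y] u(1) False by auto
      qed simp
      moreover have "(g(x := u)) y = s y" if "y \<in> V0" for y using gh(1)[OF that] that x by auto
      ultimately show ?thesis using u(2)
        by (intro exI[of _ "g(x := u)"] exI[of _ "h(u := s' x)"] conjI ballI) (simp_all only:)
    qed
  qed
  from this[of "V - V0"] show ?thesis using fin sub by (auto simp: Un_absorb1)
qed

section \<open>Truth in the cover and in the original model\<close>

lemma tm_val_cover:
  assumes "embeds Z f" "s ` tm_vars t \<subseteq> Z" "\<And>c. t = Const c \<Longrightarrow> c \<in> csyms \<phi>"
  shows "tm_val cover s t \<in> Z" "f (tm_val cover s t) = tm_val A (f \<circ> s) t"
  using assms by (cases t; auto simp: cover_def embeds_def const_in_K)+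

lemma sat_atomic_iff:
  assumes "atomic ar \<alpha>" "embeds Z f" "s ` fv \<alpha> \<subseteq> Z" "rsyms \<alpha> \<subseteq> rsyms \<phi>" "csyms \<alpha> \<subseteq> csyms \<phi>"
  shows "sat cover s \<alpha> \<longleftrightarrow> sat A (f \<circ> s) \<alpha>"
  using assms(1)
proof cases
  case (1 ts R)
  have t: "tm_val cover s t \<in> Z" "f (tm_val cover s t) = tm_val A (f \<circ> s) t" if "t \<in> set ts" for t
    using tm_val_cover[OF assms(2), of s t] assms(3,5) that 1 by force+
  have "map f (map (tm_val cover s) ts) = map (tm_val A (f \<circ> s)) ts" using t(2) by simp
  moreover have "set (map (tm_val cover s) ts) \<subseteq> Z" using t(1) by auto
  ultimately show ?thesis
    using rel_int_cover_iff[OF assms(2), of R "map (tm_val cover s) ts"] assms(4) 1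
    by (simp del: map_map map_eq_conv)
next
  case (2 t u)
  have t: "tm_val cover s t \<in> Z" "f (tm_val cover s t) = tm_val A (f \<circ> s) t"
    by (rule tm_val_cover[OF assms(2)]; use assms(3,5) 2 in auto)+
  have u: "tm_val cover s u \<in> Z" "f (tm_val cover s u) = tm_val A (f \<circ> s) u"
    by (rule tm_val_cover[OF assms(2)]; use assms(3,5) 2 in auto)+
  have "inj_on f Z" using assms(2) by (simp add: embeds_def)
  from inj_on_eq_iff[OF this t(1) u(1)] show ?thesis using t(2) u(2) 2 by simp
qed

text \<open>This is why atoms on unrealised sets are made false in the cover. Equality guards are
  covered by admitting only elements whose own type is realised.\<close>

lemma guard_imp_embeds:
  assumes "atomic ar \<gamma>" "sat cover s \<gamma>" "rsyms \<gamma> \<subseteq> rsyms \<phi>" "s ` fv \<gamma> \<subseteq> domain cover"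
  shows "\<exists>f. embeds (K \<union> s ` fv \<gamma>) f"
  using assms(1)
proof cases
  case (1 ts R)
  then obtain f where f: "embeds (K \<union> set (map (tm_val cover s) ts)) f"
    using assms(2,3) by (auto simp: cover_def good_def split: if_splits)
  have "s ` fv \<gamma> \<subseteq> set (map (tm_val cover s) ts)"
  proof
    fix a assume "a \<in> s ` fv \<gamma>"
    then obtain t x where t: "t \<in> set ts" "x \<in> tm_vars t" "a = s x" using 1 by auto
    then have "t = Var x" by (cases t rule: tm.exhaust) auto
    then have "tm_val cover s t = a" using t by simp
    then show "a \<in> set (map (tm_val cover s) ts)" using t(1) by (auto intro: rev_image_eqI)
  qed
  then show ?thesis using embeds_subset[OF f, of "K \<union> s ` fv \<gamma>"] by auto
next
  case (2 t u)
  have single: "\<exists>f. embeds (K \<union> {a}) f" if "a \<in> domain cover" for a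
    using that by (auto simp: cover_def cover_domain_def good_def)
  \<comment> \<open>A true equality guard gives all its variables the same value; the empty case
    arises when both terms are constants.\<close>
  have "s ` fv \<gamma> = {} \<or> (\<exists>a\<in>domain cover. s ` fv \<gamma> \<subseteq> {a})"
  proof (cases "fv \<gamma> = {}")
    case False
    have "s x = s y" if "x \<in> fv \<gamma>" "y \<in> fv \<gamma>" for x y
      using that assms(2) 2 by (cases t; cases u) auto
    then show ?thesis using False assms(4) by blast
  qed auto
  then show ?thesis using embeds_K single embeds_subset[of _ _ "K \<union> s ` fv \<gamma>"]
    by (metis Un_upper1 Un_mono sup_bot_right subset_refl)
qed

text \<open>A relational guard has at most as many variables as its arity; an equality guard has at
  most two, which is where \<open>k \<ge> 2\<close> enters.\<close>

lemma card_fv_guard_le: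
  fixes \<gamma> :: "('r, 'c) fm"
  assumes "atomic ar \<gamma>" "rsyms \<gamma> \<subseteq> rsyms \<phi>"
  shows "card (fv \<gamma>) \<le> k"
  using assms(1)
proof cases
  case (1 ts R)
  \<comment> \<open>Constants contribute no variable; the value \<open>0\<close> only makes the
    function total.\<close>
  have tv: "x = (case t of Var x \<Rightarrow> x | Const c \<Rightarrow> 0)" if "x \<in> tm_vars t" for x and t :: "'c tm"
    using that by (cases t) auto
  have "fv \<gamma> \<subseteq> (\<lambda>t. case t of Var x \<Rightarrow> x | Const c \<Rightarrow> 0) ` set ts"
    unfolding 1(1) fv.simps using tv by blast
  then have "card (fv \<gamma>) \<le> length ts"
    by (meson card_length surj_card_le le_trans List.finite_set)
  moreover have "ar R \<le> k" using k(1)[of "Inl R"] Inl_Rs[of R] assms(2) 1 by auto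
  ultimately show ?thesis using 1 by simp
next
  case (2 t u)
  have "card (tm_vars t) \<le> 1" for t :: "'c tm" by (cases t) auto
  from this[of t] this[of u] show ?thesis using 2 k(2) card_Un_le[of "tm_vars t" "tm_vars u"] by simp
qed

text \<open>From the cover to \<open>A\<close>, the true guard supplies an embedding
  \<open>g\<close> of the witnessing tuple. From \<open>A\<close> to the cover, a witness is lifted
  by \<open>embeds_extend_assignment\<close>, since the guard has at most \<open>k\<close>
  variables. The premise \<open>det\<close> says that truth of the block in \<open>A\<close> does
  not depend on the chosen embedding.\<close>

lemma sat_block_iff:
  assumes \<gamma>: "atomic ar \<gamma>" "rsyms \<gamma> \<subseteq> rsyms \<phi>" "csyms \<gamma> \<subseteq> csyms \<phi>"
    and fv: "set xs \<union> fv \<psi> \<subseteq> fv \<gamma>"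
    and IH: "\<And>Z f s. embeds Z f \<Longrightarrow> s ` fv \<psi> \<subseteq> Z \<Longrightarrow> sat cover s \<psi> \<longleftrightarrow> sat A (f \<circ> s) \<psi>"
    and det: "\<And>Z f g s. embeds Z f \<Longrightarrow> embeds Z g \<Longrightarrow> s ` (fv \<gamma> - set xs) \<subseteq> Z \<Longrightarrow>
      sat A (f \<circ> s) (foldr Ex xs (And \<gamma> \<psi>)) \<longleftrightarrow> sat A (g \<circ> s) (foldr Ex xs (And \<gamma> \<psi>))"
    and embeds: "embeds Z f" and s: "s ` (fv \<gamma> - set xs) \<subseteq> Z"
  shows "sat cover s (foldr Ex xs (And \<gamma> \<psi>)) \<longleftrightarrow> sat A (f \<circ> s) (foldr Ex xs (And \<gamma> \<psi>))"
proof
  let ?V0 = "fv \<gamma> - set xs"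
  have "K \<subseteq> Z" using embeds by (simp add: embeds_def)
  then have embeds0: "embeds (K \<union> s ` ?V0) f" using embeds_subset[OF embeds, of "K \<union> s ` ?V0"] s by auto
  {
    assume "sat cover s (foldr Ex xs (And \<gamma> \<psi>))"
    then obtain s1 where s1: "\<And>x. x \<notin> set xs \<Longrightarrow> s1 x = s x" "s1 ` set xs \<subseteq> domain cover"
      "sat cover s1 \<gamma>" "sat cover s1 \<psi>"
      unfolding sat_foldr_Ex by auto
    have "s1 ` fv \<gamma> \<subseteq> domain cover"
      using s1(1,2) embeds_domain[OF embeds] s by (smt (verit) Diff_iff image_subset_iff subsetD)
    then obtain g where g: "embeds (K \<union> s1 ` fv \<gamma>) g" using guard_imp_embeds[OF \<gamma>(1) s1(3) \<gamma>(2)] by blast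
    have "sat A (g \<circ> s1) \<gamma>" using sat_atomic_iff[OF \<gamma>(1) g, of s1] \<gamma> s1(3) by auto
    moreover have "sat A (g \<circ> s1) \<psi>" using IH[OF g, of s1] s1(4) fv by auto
    moreover have "(g \<circ> s1) ` set xs \<subseteq> domain A"
    proof -
      have "g ` (K \<union> s1 ` fv \<gamma>) \<subseteq> domain A" using g by (simp add: embeds_def)
      then show ?thesis using fv by auto
    qed
    ultimately have "sat A (g \<circ> s) (foldr Ex xs (And \<gamma> \<psi>))"
      unfolding sat_foldr_Ex using s1(1) by (intro exI[of _ "g \<circ> s1"]) auto
    \<comment> \<open>\<open>f\<close> and \<open>g\<close> may map the common part to different
      tuples of the same type; \<open>det\<close> moves truth from \<open>g\<close> to
      \<open>f\<close>.\<close>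
    moreover have "embeds (K \<union> s ` ?V0) g"
      by (rule embeds_subset[OF g]) (use s1(1) in force)+
    ultimately show "sat A (f \<circ> s) (foldr Ex xs (And \<gamma> \<psi>))" using det[OF embeds0, of g s] by auto
  next
    assume "sat A (f \<circ> s) (foldr Ex xs (And \<gamma> \<psi>))"
    then obtain s' where s': "\<And>x. x \<notin> set xs \<Longrightarrow> s' x = f (s x)" "s' ` set xs \<subseteq> domain A"
      "sat A s' \<gamma>" "sat A s' \<psi>"
      unfolding sat_foldr_Ex by auto
    have "s' ` fv \<gamma> \<subseteq> domain A"
    proof
      fix a assume "a \<in> s' ` fv \<gamma>"
      then obtain x where x: "x \<in> fv \<gamma>" "a = s' x" by auto
      show "a \<in> domain A"
      proof (cases "x \<in> set xs")
        case False
        then have "s x \<in> Z" using s x by auto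
        then show ?thesis using s'(1)[OF False] x embeds by (auto simp: embeds_def)
      qed (use s'(2) x in auto)
    qed
    then have "\<exists>g h. (\<forall>x\<in>?V0. g x = s x) \<and> embeds (K \<union> g ` fv \<gamma>) h \<and> (\<forall>x\<in>fv \<gamma>. h (g x) = s' x)"
      using s'(1) by (intro embeds_extend_assignment[OF finite_fv _ card_fv_guard_le[OF \<gamma>(1,2)] embeds0]) auto
    then obtain g h where gh: "\<And>x. x \<in> ?V0 \<Longrightarrow> g x = s x" "embeds (K \<union> g ` fv \<gamma>) h"
      "\<And>x. x \<in> fv \<gamma> \<Longrightarrow> h (g x) = s' x"
      by blast
    have "sat A (h \<circ> g) \<gamma>" "sat A (h \<circ> g) \<psi>"
      using sat_cong[of \<gamma> "h \<circ> g" s' A] sat_cong[of \<psi> "h \<circ> g" s' A] gh(3) s'(3,4) fv by auto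
    moreover have "g ` fv \<psi> \<subseteq> K \<union> g ` fv \<gamma>" using fv by blast
    ultimately have "sat cover g \<gamma>" "sat cover g \<psi>"
      using sat_atomic_iff[OF \<gamma>(1) gh(2), of g] \<gamma> IH[OF gh(2), of g] fv by auto
    then have "sat cover g (foldr Ex xs (And \<gamma> \<psi>))"
      unfolding sat_foldr_Ex using embeds_domain[OF gh(2)] fv by (intro exI[of _ g]) auto
    then show "sat cover s (foldr Ex xs (And \<gamma> \<psi>))"
      using sat_cong[of "foldr Ex xs (And \<gamma> \<psi>)" g s cover] gh(1) fv by auto
  }
qed

text \<open>This is what the fresh symbols are for: a realised type fixes the truth value of every
  block subformula.\<close>

lemma block_determined:
  assumes \<chi>: "\<chi> \<in> block_subfms False \<phi>" and f: "embeds Z f" and g: "embeds Z g" and s: "s ` fv \<chi> \<subseteq> Z"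
  shows "sat A (f \<circ> s) \<chi> \<longleftrightarrow> sat A (g \<circ> s) \<chi>"
proof (cases "fv \<chi> = {}")
  case True
  then show ?thesis by (intro sat_cong) auto
next
  case False
  let ?as = "map s (sorted_list_of_set (fv \<chi>))"
  have R: "Inr \<chi> \<in> Rs" "length ?as = r (Inr \<chi>)" "set ?as \<subseteq> Z"
    using False \<chi> s finite_fv[of \<chi>] by (auto simp: Rs r nf_sig_def)
  \<comment> \<open>The fact on the right does not mention \<open>h\<close>, so all embeddings give
    the same truth value.\<close>
  have "sat A (h \<circ> s) \<chi> \<longleftrightarrow> (Inr \<chi>, ?as) \<in> W" if "embeds Z h" for h
  proof -
    have "(Inr \<chi>, ?as) \<in> W \<longleftrightarrow> map h ?as \<in> nf_int A (Inr \<chi>)" using that R unfolding embeds_def by blast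
    then show ?thesis by (simp add: map_in_nf_int_Inr)
  qed
  then show ?thesis using f g by simp
qed

text \<open>Atoms are preserved because embeddings are isomorphisms, blocks by
  \<open>sat_block_iff\<close>, whose premise \<open>det\<close> comes from the fresh symbols
  through \<open>block_determined\<close>.\<close>

lemma sat_cover_iff:
  assumes "GF ar \<psi>" "block_subfms False \<psi> \<subseteq> block_subfms False \<phi>"
    "rsyms \<psi> \<subseteq> rsyms \<phi>" "csyms \<psi> \<subseteq> csyms \<phi>" "embeds Z f" "s ` fv \<psi> \<subseteq> Z"
  shows "sat cover s \<psi> \<longleftrightarrow> sat A (f \<circ> s) \<psi>"
  using assms
proof (induction arbitrary: Z f s rule: GF.induct)
  case (1 \<alpha>)
  then show ?case by (intro sat_atomic_iff)
next
  case (7 \<psi> \<gamma> xs)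
  have sub: "block_subfms False \<psi> \<subseteq> block_subfms False \<phi>"
    using block_subfms_guarded(1) 7(5) by (rule subset_trans)
  have IH: "sat cover s \<psi> \<longleftrightarrow> sat A (f \<circ> s) \<psi>" if "embeds Z f" "s ` fv \<psi> \<subseteq> Z" for Z f s
    by (rule 7(4)) (use sub 7 that in auto)
  have fv: "fv (foldr Ex xs (And \<gamma> \<psi>)) = fv \<gamma> - set xs" using 7 by auto
  show ?case
  proof (cases "xs = []")
    \<comment> \<open>An empty block is a mere conjunction of guard and body and need not have a
      fresh symbol.\<close>
    case True
    have "sat cover s \<gamma> \<longleftrightarrow> sat A (f \<circ> s) \<gamma>" "sat cover s \<psi> \<longleftrightarrow> sat A (f \<circ> s) \<psi>"
      by (rule sat_atomic_iff[of _ Z] IH[of Z]; use True 7 in auto)+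
    then show ?thesis using True by (simp add: comp_def)
  next
    case False
    show ?thesis
    proof (rule sat_block_iff[OF 7(2) _ _ 7(3) IH])
      show "sat A (f \<circ> s) (foldr Ex xs (And \<gamma> \<psi>)) \<longleftrightarrow> sat A (g \<circ> s) (foldr Ex xs (And \<gamma> \<psi>))"
        if "embeds Z f" "embeds Z g" "s ` (fv \<gamma> - set xs) \<subseteq> Z" for Z f g s
        by (rule block_determined[OF _ that(1,2)])
          (use foldr_in_block_subfms(1)[OF False, of "And \<gamma> \<psi>"] 7(5) that fv in auto)
    qed (use 7 fv in auto)
  qed
next
  case (8 \<psi> \<gamma> xs)
  have sub: "block_subfms False \<psi> \<subseteq> block_subfms False \<phi>"
    using block_subfms_guarded(2) 8(5) by (rule subset_trans)
  have IH: "sat cover s \<psi> \<longleftrightarrow> sat A (f \<circ> s) \<psi>" if "embeds Z f" "s ` fv \<psi> \<subseteq> Z" for Z f s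
    by (rule 8(4)) (use sub 8 that in auto)
  have fv: "fv (foldr All xs (Imp \<gamma> \<psi>)) = fv \<gamma> - set xs" using 8 by auto
  show ?case
  proof (cases "xs = []")
    case True
    have "sat cover s \<gamma> \<longleftrightarrow> sat A (f \<circ> s) \<gamma>" "sat cover s \<psi> \<longleftrightarrow> sat A (f \<circ> s) \<psi>"
      by (rule sat_atomic_iff[of _ Z] IH[of Z]; use True 8 in auto)+
    then show ?thesis using True by (simp add: comp_def)
  next
    case False
    \<comment> \<open>The fresh symbol belongs to the universal block; it determines the dual
      existential block as well.\<close>
    have "sat cover s (foldr Ex xs (And \<gamma> (Neg \<psi>))) \<longleftrightarrow> sat A (f \<circ> s) (foldr Ex xs (And \<gamma> (Neg \<psi>)))"
    proof (rule sat_block_iff[OF 8(2)])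
      show "sat A (f \<circ> s) (foldr Ex xs (And \<gamma> (Neg \<psi>))) \<longleftrightarrow> sat A (g \<circ> s) (foldr Ex xs (And \<gamma> (Neg \<psi>)))"
        if "embeds Z f" "embeds Z g" "s ` (fv \<gamma> - set xs) \<subseteq> Z" for Z f g s
        using block_determined[OF _ that(1,2), of "foldr All xs (Imp \<gamma> \<psi>)" s]
          foldr_in_block_subfms(2)[OF False, of "Imp \<gamma> \<psi>"] 8(5) that(3) fv
        unfolding sat_foldr_All_iff by auto
    qed (use 8 fv IH in auto)
    then show ?thesis unfolding sat_foldr_All_iff by simp
  qed
next
  case (2 \<psi>)
  show ?case using "2.IH"[of Z f s] "2.prems" by simp
next
  case (3 \<psi>\<^sub>1 \<psi>\<^sub>2)
  show ?case using "3.IH"(1)[of Z f s] "3.IH"(2)[of Z f s] "3.prems" by (simp add: image_Un)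
next
  case (4 \<psi>\<^sub>1 \<psi>\<^sub>2)
  show ?case using "4.IH"(1)[of Z f s] "4.IH"(2)[of Z f s] "4.prems" by (simp add: image_Un)
next
  case (5 \<psi>\<^sub>1 \<psi>\<^sub>2)
  show ?case using "5.IH"(1)[of Z f s] "5.IH"(2)[of Z f s] "5.prems" by (simp add: image_Un)
next
  case (6 \<psi>\<^sub>1 \<psi>\<^sub>2)
  show ?case using "6.IH"(1)[of Z f s] "6.IH"(2)[of Z f s] "6.prems" by (simp add: image_Un)
qed

section \<open>The cover as a finite model\<close>

text \<open>Either all elements of \<open>A\<close> are constants, and these survive in the cover,
  or a further element of \<open>A\<close> is matched by extending the identity on
  \<open>K\<close>.\<close>

lemma cover_nonempty: "domain cover \<noteq> {}"
proof (cases "domain A \<subseteq> K")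
  case True
  then show ?thesis using A K_subset_domain by (auto simp: is_struct_def)
next
  case False
  then obtain a where "a \<in> domain A" "a \<notin> id ` K" by auto
  then obtain u where "embeds (insert u K) (id(u := a))" using embeds_extend[OF embeds_K] k(2) by auto
  then show ?thesis using embeds_domain by blast
qed

lemma is_model_cover:
  assumes "GF ar \<phi>" "sentence \<phi>" "is_model ar A \<phi>"
  shows "is_model ar cover \<phi>"
  unfolding is_model_def
proof (intro conjI allI impI)
  have "set as \<subseteq> domain cover" if as: "good (set as)" for as
  proof -
    obtain f where "embeds (K \<union> set as) f" using as by (auto simp: good_def)
    from embeds_domain[OF this] show ?thesis by simp
  qed
  moreover have "const_int cover c \<in> domain cover" for c
  proof (cases "c \<in> csyms \<phi>")
    case True
    then show ?thesis using K_subset_domain const_in_K by (auto simp: cover_def)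
  next
    case False
    then show ?thesis using cover_nonempty some_in_eq[of cover_domain] by (auto simp: cover_def)
  qed
  ultimately show "is_struct ar cover"
    unfolding is_struct_def using cover_nonempty by (auto simp: cover_def)
  fix s
  obtain a where a: "a \<in> domain A" using A by (auto simp: is_struct_def)
  have "sat A (\<lambda>_. a) \<phi>" using assms(3) a by (auto simp: is_model_def)
  then have "sat A (id \<circ> s) \<phi>"
    using assms(2) sat_cong[of \<phi> "\<lambda>_. a" "id \<circ> s" A] by (auto simp: sentence_def)
  \<comment> \<open>A sentence has no free variables, so the identity embedding of the constants
    already transfers it.\<close>
  then show "sat cover s \<phi>"
    using sat_cover_iff[OF assms(1) _ _ _ embeds_K, of s] assms(2) by (auto simp: sentence_def)
qed

lemma card_cover_le:
  assumes "finite K" "finite U"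
  shows "finite (domain cover)" "card (domain cover) \<le> card K + card U"
proof -
  have sub: "domain cover \<subseteq> K \<union> U" by (auto simp: cover_def cover_domain_def)
  then show "finite (domain cover)" using assms finite_subset by blast
  have "card (domain cover) \<le> card (K \<union> U)" using sub assms by (intro card_mono) auto
  then show "card (domain cover) \<le> card K + card U" using card_Un_le[of K U] by linarith
qed

end

section \<open>Bounds\<close>

text \<open>With \<open>l = real L\<close>, the three factors are at most
  \<open>exp (5 * l\<^sup>2)\<close>, \<open>exp l\<close> and \<open>exp (- 8 * l\<^sup>2)\<close>,
  and \<open>l - 3 * l\<^sup>2\<close> is negative for \<open>l \<ge> 1\<close>.\<close>

lemma union_bound_small:
  fixes k L Q N :: nat
  assumes "k \<le> L" "Q \<le> L" "L \<ge> 1" and N: "N = 2 ^ Q * (8 * L\<^sup>2) + k"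
  shows "(real N + 1) ^ k * 2 ^ Q * (1 - 1 / 2 ^ Q) ^ (N + 1 - k) < 1"
proof -
  define l where "l = real L"
  have l: "l \<ge> 1" "real k \<le> l" "real Q \<le> l" using assms by (auto simp: l_def)
  have two: "(2::real) ^ n \<le> exp (real n)" for n
    using power_mono[of 2 "exp (1::real)" n] exp_ge_add_one_self[of 1] by (simp add: exp_of_nat_mult[symmetric])
  have "8 * l\<^sup>2 + l + 1 \<le> 16 * l\<^sup>2" using l self_le_power[of l 2] by simp
  also have "\<dots> = (4 * l)\<^sup>2" by (simp add: power2_eq_square)
  also have "\<dots> \<le> ((1 + l)\<^sup>2)\<^sup>2"
    using l sum_power2_ge_zero[of "1 - l" 0] by (intro power_mono) (auto simp: power2_eq_square algebra_simps)
  also have "\<dots> \<le> ((exp l)\<^sup>2)\<^sup>2"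
    using l exp_ge_add_one_self[of l] by (intro power_mono) auto
  also have "\<dots> = exp (4 * l)" by (simp flip: exp_of_nat_mult)
  finally have poly: "8 * l\<^sup>2 + l + 1 \<le> exp (4 * l)" .
  have "real N + 1 \<le> 2 ^ Q * (8 * l\<^sup>2 + l + 1)"
  proof -
    have "l + 1 \<le> 2 ^ Q * (l + 1)" using l by (simp add: mult_le_cancel_right1)
    then show ?thesis using l by (simp add: N l_def algebra_simps)
  qed
  also have "\<dots> \<le> exp l * exp (4 * l)"
    using two[of Q] l poly by (intro mult_mono) (auto intro: order_trans)
  also have "\<dots> = exp (5 * l)" by (simp flip: exp_add)
  finally have "(real N + 1) ^ k \<le> exp (5 * l) ^ k" by (intro power_mono) auto
  also have "\<dots> = exp (real k * (5 * l))" by (simp add: exp_of_nat_mult)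
  also have "\<dots> \<le> exp (5 * l\<^sup>2)" using l by (simp add: power2_eq_square mult_right_mono)
  finally have a: "(real N + 1) ^ k \<le> exp (5 * l\<^sup>2)" .
  have b: "(2::real) ^ Q \<le> exp l" using two[of Q] l by (auto intro: order_trans)
  \<comment> \<open>The summand \<open>k\<close> of \<open>N\<close> makes up for the subtracted
    \<open>k\<close>; then \<open>1 - x \<le> exp (- x)\<close> at \<open>x = 1 / 2 ^ Q\<close>
    cancels the factor \<open>2 ^ Q\<close> in the exponent.\<close>
  have "(1 - 1 / 2 ^ Q :: real) ^ (N + 1 - k) \<le> (1 - 1 / 2 ^ Q) ^ (2 ^ Q * (8 * L\<^sup>2))"
    by (rule power_decreasing) (auto simp: N)
  also have "\<dots> \<le> exp (- (1 / 2 ^ Q)) ^ (2 ^ Q * (8 * L\<^sup>2))"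
    using exp_ge_add_one_self[of "- (1 / 2 ^ Q)"] by (intro power_mono) auto
  also have "\<dots> = exp (- 8 * l\<^sup>2)" by (simp add: l_def flip: exp_of_nat_mult)
  finally have c: "(1 - 1 / 2 ^ Q :: real) ^ (N + 1 - k) \<le> exp (- 8 * l\<^sup>2)" .
  have "(real N + 1) ^ k * 2 ^ Q * (1 - 1 / 2 ^ Q) ^ (N + 1 - k) \<le> exp (5 * l\<^sup>2) * exp l * exp (- 8 * l\<^sup>2)"
    by (intro mult_mono a b c) auto
  also have "\<dots> = exp (l - 3 * l\<^sup>2)" by (simp flip: exp_add)
  also have "\<dots> < 1" using l mult_mono[of 1 l l l] by (simp add: power2_eq_square)
  finally show ?thesis .
qed

text \<open>With \<open>m = k - 1\<close>, \<open>1 - 1 / k\<close> is the inverse of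
  \<open>1 + 1 / m\<close> and hence at least \<open>exp (- 1 / m)\<close>. So the first
  \<open>m\<close> factors give \<open>1 / exp 1\<close>, and the last one is at least
  \<open>1 - 1 / t\<close>.\<close>

lemma one_minus_inverse_power_ge:
  assumes "2 \<le> t" "t \<le> (k :: nat)"
  shows "(1 - 1 / real t) / exp 1 \<le> (1 - 1 / real k) ^ k"
proof -
  obtain m where m: "k = Suc m" "m \<ge> 1" using assms by (cases k) auto
  have "exp (- (1 / real m)) \<le> 1 - 1 / real k"
  proof -
    have "1 + 1 / real m \<le> exp (1 / real m)" by simp
    then have "inverse (exp (1 / real m)) \<le> inverse (1 + 1 / real m)"
      using m by (intro le_imp_inverse_le) (auto intro: add_pos_nonneg)
    also have "\<dots> = 1 - 1 / real k" using m by (simp add: field_simps)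
    finally show ?thesis by (simp add: exp_minus)
  qed
  then have "exp (- (1 / real m)) ^ m \<le> (1 - 1 / real k) ^ m" by (intro power_mono) auto
  moreover have "exp (- (1 / real m)) ^ m = 1 / exp 1"
    using m(2) exp_of_nat_mult[of m "- (1 / real m)"] by (simp add: exp_minus inverse_eq_divide)
  ultimately have "1 / exp 1 \<le> (1 - 1 / real k) ^ m" by simp
  moreover have "1 - 1 / real t \<le> 1 - 1 / real k" using assms by (simp add: frac_le)
  ultimately have "(1 - 1 / real t) * (1 / exp 1) \<le> (1 - 1 / real k) * (1 - 1 / real k) ^ m"
    using assms by (intro mult_mono) auto
  then show ?thesis by (simp add: m(1))
qed

text \<open>Among the atoms of a symbol of arity \<open>n\<close>, those avoiding one variable have
  proportion at least \<open>(1 - 1 / k) ^ n\<close>, as constants only raise it. Because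
  \<open>n \<le> k\<close>, this is at least \<open>(1 - 1 / k) ^ k\<close>, and
  \<open>1 / (real t * exp 1)\<close> is the deviation of its lower bound from
  \<open>1 / exp 1\<close>.\<close>

lemma sum_power_diff_le:
  fixes r :: "'r \<Rightarrow> nat"
  assumes r: "\<And>R. R \<in> Rs \<Longrightarrow> r R \<le> k" and t: "2 \<le> t" "t \<le> k"
  shows "real (\<Sum>R\<in>Rs. (k + c) ^ r R - (k - 1 + c) ^ r R)
    \<le> (1 - 1 / exp 1 + 1 / (real t * exp 1)) * real (\<Sum>R\<in>Rs. (k + c) ^ r R)"
proof -
  have "real ((k + c) ^ n - (k - 1 + c) ^ n)
      \<le> (1 - 1 / exp 1 + 1 / (real t * exp 1)) * real ((k + c) ^ n)" if n: "n \<le> k" for n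
  proof -
    let ?q = "1 - 1 / real k"
    have q: "0 \<le> ?q" "?q \<le> 1" using t by auto
    have "?q * real (k + c) \<le> real (k - 1 + c)" using t by (simp add: field_simps of_nat_diff)
    then have "(?q * real (k + c)) ^ n \<le> real (k - 1 + c) ^ n" using q by (intro power_mono) auto
    moreover have "(1 - 1 / real t) / exp 1 * real (k + c) ^ n \<le> ?q ^ n * real (k + c) ^ n"
      using one_minus_inverse_power_ge[OF t] power_decreasing[OF n q] by (intro mult_right_mono) auto
    ultimately have "(1 - 1 / real t) / exp 1 * real (k + c) ^ n \<le> real (k - 1 + c) ^ n"
      unfolding power_mult_distrib by linarith
    moreover have "real ((k + c) ^ n - (k - 1 + c) ^ n) = real (k + c) ^ n - real (k - 1 + c) ^ n"
      by (subst of_nat_diff) (auto intro: power_mono)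
    moreover have "(1 - 1 / exp 1 + 1 / (real t * exp 1)) * real (k + c) ^ n
        = real (k + c) ^ n - (1 - 1 / real t) / exp 1 * real (k + c) ^ n"
      by (simp add: algebra_simps diff_divide_distrib)
    ultimately show ?thesis by simp
  qed
  then show ?thesis
    unfolding of_nat_sum sum_distrib_left using r by (intro sum_mono) auto
qed

text \<open>Squaring \<open>y \<le> exp y\<close> for a suitable multiple \<open>y\<close> of
  \<open>x\<close>. It absorbs the factor \<open>L\<^sup>2\<close> of the model size into an
  arbitrarily small increase of the exponent.\<close>

lemma square_le_powr:
  fixes x \<eta> :: real
  assumes "\<eta> > 0" "x \<ge> 0"
  shows "x\<^sup>2 \<le> (2 / (\<eta> * ln 2))\<^sup>2 * 2 powr (\<eta> * x)"
proof -
  define y where "y = \<eta> * ln 2 / 2 * x"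
  have y: "0 \<le> y" "x = 2 / (\<eta> * ln 2) * y" using assms by (auto simp: y_def)
  have "y \<le> exp y" using exp_ge_add_one_self[of y] by linarith
  then have "y\<^sup>2 \<le> (exp y)\<^sup>2" using y by (intro power_mono)
  also have "\<dots> = 2 powr (\<eta> * x)" by (simp add: powr_def y_def mult_ac flip: exp_of_nat_mult)
  finally have "(2 / (\<eta> * ln 2))\<^sup>2 * y\<^sup>2 \<le> (2 / (\<eta> * ln 2))\<^sup>2 * 2 powr (\<eta> * x)"
    by (intro mult_left_mono) auto
  then show ?thesis by (subst y(2), simp only: power_mult_distrib)
qed

section \<open>Small finite models\<close>

lemma finite_block_subfms: "finite (block_subfms b \<phi>)"
  by (induction \<phi> arbitrary: b) auto

lemma signature_nf_sig:
  assumes "signature (induced_sig ar \<phi>)"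
  shows "signature (nf_sig ar \<phi>)"
  using assms finite_block_subfms[of False \<phi>]
  by (auto simp: signature_def nf_sig_def induced_sig_def Suc_le_eq card_gt_0_iff finite_fv)

text \<open>The cover is built over \<open>N = 2 ^ Q * (8 * L\<^sup>2) + k\<close> points besides
  the constants; the remaining \<open>k + c \<le> L\<close> points are absorbed by the ninth copy of
  \<open>L\<^sup>2\<close>.\<close>

lemma GF_finite_model:
  fixes ar :: "nat \<Rightarrow> nat" and \<phi> :: "(nat, nat) fm"
  assumes sig: "signature (induced_sig ar \<phi>)" and \<phi>: "GF ar \<phi>" "sentence \<phi>" "satisfiable ar \<phi>"
    and k: "k = wd (nf_sig ar \<phi>)" "k \<ge> 2"
    and Rs: "Rs = rels (nf_sig ar \<phi>)" and r: "r = arity (nf_sig ar \<phi>)" and c: "c = card (csyms \<phi>)"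
    and L: "L = (\<Sum>R\<in>Rs. (k + c) ^ r R)"
    and Q: "Q = (\<Sum>R\<in>Rs. (k + c) ^ r R - (k - 1 + c) ^ r R)"
  shows "\<exists>M :: (nat, nat, nat) struct. is_model ar M \<phi> \<and> finite (domain M) \<and>
    card (domain M) \<le> 2 ^ Q * (9 * L\<^sup>2)"
proof -
  have nf: "finite Rs" "Rs \<noteq> {}" "finite (csyms \<phi>)"
    using signature_nf_sig[OF sig] sig by (auto simp: Rs signature_def induced_sig_def)
  have r_le: "r R \<le> k" if "R \<in> Rs" for R
    using that nf by (simp add: k wd_def flip: Rs r)
  have "Max (r ` Rs) \<in> r ` Rs" using nf by (intro Max_in) auto
  \<comment> \<open>A symbol attaining the width; its atoms alone show
    \<open>k + c \<le> L\<close>.\<close>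
  then obtain R0 where R0: "R0 \<in> Rs" "r R0 = k" by (auto simp: k wd_def simp flip: Rs r)
  have "(k + c) ^ 1 \<le> (k + c) ^ k" using k(2) by (intro power_increasing) auto
  also have "\<dots> \<le> L" unfolding L using R0 nf member_le_sum[of R0 Rs "\<lambda>R. (k + c) ^ r R"] by simp
  finally have kc: "k + c \<le> L" by simp
  have QL: "Q \<le> L" unfolding Q L by (intro sum_mono) auto
  obtain A :: "(nat, nat, nat) struct" where A: "is_model ar A \<phi>" using \<phi> by (auto simp: satisfiable_def)
  define K where "K = const_int A ` csyms \<phi>"
  have K: "finite K" "card K \<le> c" using nf by (auto simp: K_def c card_image_le)
  define N where "N = 2 ^ Q * (8 * L\<^sup>2) + k"
  have "infinite (UNIV - K)" using K(1) by (intro Diff_infinite_finite) auto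
  then obtain U where U: "finite U" "card U = N" "U \<subseteq> UNIV - K"
    using infinite_arbitrarily_large by blast
  obtain star where star: "star \<notin> K \<union> U" using K(1) U(1) ex_new_if_finite[of "K \<union> U"] by auto
  have KU: "K \<inter> U = {}" using U by auto
  have "(real (card U) + 1) ^ k * 2 ^ Q * (1 - 1 / 2 ^ Q) ^ (card U + 1 - k) < 1"
    by (rule union_bound_small[of k L]) (use kc QL k(2) U(2) in \<open>auto simp: N_def\<close>)
  moreover have "1 \<le> k" using k(2) by simp
  ultimately obtain W where W: "\<forall>S T. S \<subseteq> U \<longrightarrow> card S < k \<longrightarrow>
    (\<exists>u\<in>U - S. \<forall>R\<in>Rs. \<forall>as. length as = r R \<longrightarrow> set as \<subseteq> insert u (K \<union> S) \<longrightarrow> u \<in> set as \<longrightarrow>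
       ((R, as) \<in> W \<longleftrightarrow> map (id(u := star)) as \<in> T R))"
    using exists_extension_structure[OF nf(1) K(1) U(1) KU star K(2) _ Q] by blast
  \<comment> \<open>Facts about constants alone are copied from the expansion of \<open>A\<close>.
    The extension axioms survive, since they concern only tuples containing a point outside
    \<open>K\<close>.\<close>
  define W' where "W' = {(R, as). if set as \<subseteq> K then as \<in> nf_int A R else (R, as) \<in> W}"
  interpret gc: generic_cover ar \<phi> A K U W' star k Rs r
  proof
    show "is_struct ar A" using A by (simp add: is_model_def)
    show "Rs = rels (nf_sig ar \<phi>)" "r = arity (nf_sig ar \<phi>)" by fact+
    fix S T assume S: "S \<subseteq> U" "card S < k"
    obtain u where u: "u \<in> U - S" "\<forall>R\<in>Rs. \<forall>as. length as = r R \<longrightarrow> set as \<subseteq> insert u (K \<union> S) \<longrightarrow>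
        u \<in> set as \<longrightarrow> ((R, as) \<in> W \<longleftrightarrow> map (id(u := star)) as \<in> T R)"
      using W[THEN spec, THEN spec, THEN mp, THEN mp, OF S, of T] by blast
    have "(R, as) \<in> W' \<longleftrightarrow> (R, as) \<in> W" if "u \<in> set as" for R as
      using that u(1) KU by (auto simp: W'_def)
    then show "\<exists>u\<in>U - S. \<forall>R\<in>Rs. \<forall>as. length as = r R \<longrightarrow> set as \<subseteq> insert u (K \<union> S) \<longrightarrow>
        u \<in> set as \<longrightarrow> ((R, as) \<in> W' \<longleftrightarrow> map (id(u := star)) as \<in> T R)"
      using u by (intro bexI[of _ u]) simp_all
  qed (use K_def KU star r_le k(2) in \<open>auto simp: W'_def\<close>)
  have "card (domain gc.cover) \<le> card K + card U" by (rule gc.card_cover_le[OF K(1) U(1)])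
  also have "\<dots> \<le> 2 ^ Q * (8 * L\<^sup>2) + L" using K(2) U(2) kc by (simp add: N_def)
  also have "\<dots> \<le> 2 ^ Q * (9 * L\<^sup>2)"
  proof -
    have "1 * L \<le> 2 ^ Q * L\<^sup>2" by (intro mult_le_mono) (auto simp: power2_eq_square)
    then show ?thesis by (simp add: mult.commute)
  qed
  finally show ?thesis using gc.is_model_cover[OF \<phi>(1,2) A] gc.card_cover_le(1)[OF K(1) U(1)] by blast
qed

theorem theorem2:
  shows "\<exists>C \<epsilon> :: nat \<Rightarrow> real.
    (\<forall>t. C t > 0) \<and> (\<forall>t. 0 < \<epsilon> t \<and> \<epsilon> t < 1 / exp 1) \<and> \<epsilon> \<longlonglongrightarrow> 0 \<and>
    (\<forall>t. \<forall>(ar :: nat \<Rightarrow> nat) (\<phi> :: (nat, nat) fm) k.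
       signature (induced_sig ar \<phi>) \<longrightarrow> GF ar \<phi> \<longrightarrow> sentence \<phi> \<longrightarrow> satisfiable ar \<phi> \<longrightarrow>
       k = wd (nf_sig ar \<phi>) \<longrightarrow> k \<ge> t \<longrightarrow> t \<ge> 2 \<longrightarrow>
       (\<exists>M :: (nat, nat, nat) struct. is_model ar M \<phi> \<and> finite (domain M) \<and>
          real (card (domain M)) \<le>
            C t * real (card (ktypes k (nf_sig ar \<phi>))) powr (1 - 1 / exp 1 + \<epsilon> t)))"
proof -
  \<comment> \<open>For \<open>t \<ge> 2\<close>, \<open>\<epsilon> t\<close> is the loss
    \<open>1 / (real t * exp 1)\<close> from \<open>sum_power_diff_le\<close> plus the amount
    \<open>\<eta> t\<close> that pays for \<open>L\<^sup>2\<close>. The maximum with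
    \<open>2\<close> keeps \<open>\<epsilon> t\<close> positive and below \<open>1 / exp 1\<close>
    for every \<open>t\<close>.\<close>
  define \<eta> where "\<eta> t = 1 / (2 * real (max t 2) * exp 1)" for t
  define \<epsilon> where "\<epsilon> t = 3 / (2 * real (max t 2) * exp 1)" for t
  \<comment> \<open>The \<open>9\<close> comes from the size bound of the model, the square from
    \<open>square_le_powr\<close>.\<close>
  define C where "C t = 9 * (2 / (\<eta> t * ln 2))\<^sup>2" for t
  have \<eta>: "\<eta> t > 0" for t by (simp add: \<eta>_def)
  have "C t > 0" for t using \<eta>[of t] by (auto simp: C_def)
  moreover have "0 < \<epsilon> t \<and> \<epsilon> t < 1 / exp 1" for t by (simp add: \<epsilon>_def field_simps)
  moreover have "\<epsilon> \<longlonglongrightarrow> 0"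
  proof (rule Lim_transform_eventually)
    have "(\<lambda>t. 3 / (2 * exp 1) * (1 / real t)) \<longlonglongrightarrow> 3 / (2 * exp 1) * 0"
      by (intro tendsto_mult_left lim_1_over_n)
    then show "(\<lambda>t. 3 / (2 * exp 1) * (1 / real t)) \<longlonglongrightarrow> 0" by simp
    show "\<forall>\<^sub>F t in sequentially. 3 / (2 * exp 1) * (1 / real t) = \<epsilon> t"
      using eventually_ge_at_top[of 2] by eventually_elim (simp add: \<epsilon>_def max_def)
  qed
  moreover have "\<exists>M :: (nat, nat, nat) struct. is_model ar M \<phi> \<and> finite (domain M) \<and>
      real (card (domain M)) \<le> C t * real (card (ktypes k (nf_sig ar \<phi>))) powr (1 - 1 / exp 1 + \<epsilon> t)"
    if sig: "signature (induced_sig ar \<phi>)" and \<phi>: "GF ar \<phi>" "sentence \<phi>" "satisfiable ar \<phi>"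
      and k: "k = wd (nf_sig ar \<phi>)" and t: "t \<le> k" "2 \<le> t"
    for t k and ar :: "nat \<Rightarrow> nat" and \<phi> :: "(nat, nat) fm"
  proof -
    define Rs where "Rs = rels (nf_sig ar \<phi>)"
    define r where "r = arity (nf_sig ar \<phi>)"
    define c where "c = card (csyms \<phi>)"
    define L where "L = (\<Sum>R\<in>Rs. (k + c) ^ r R)"
    define Q where "Q = (\<Sum>R\<in>Rs. (k + c) ^ r R - (k - 1 + c) ^ r R)"
    obtain M :: "(nat, nat, nat) struct" where
      M: "is_model ar M \<phi>" "finite (domain M)" "card (domain M) \<le> 2 ^ Q * (9 * L\<^sup>2)"
      using GF_finite_model[OF sig \<phi> k _ Rs_def r_def c_def L_def Q_def] t by auto
    have cons: "card (cons (nf_sig ar \<phi>)) = c" by (simp add: nf_sig_def induced_sig_def c_def)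
    have types: "real (card (ktypes k (nf_sig ar \<phi>))) = 2 powr real L"
      using card_ktypes[OF signature_nf_sig[OF sig], of k]
      by (simp add: cons L_def Rs_def r_def power_sum powr_realpow del: of_nat_sum)
    have "r R \<le> k" if "R \<in> Rs" for R
      using that signature_nf_sig[OF sig] by (simp add: k wd_def signature_def Rs_def r_def)
    then have "real Q \<le> (1 - 1 / exp 1 + 1 / (real t * exp 1)) * real L"
      unfolding Q_def L_def by (rule sum_power_diff_le) (use t in auto)
    moreover have "1 / (real t * exp 1) + \<eta> t = \<epsilon> t"
      using t by (simp add: \<eta>_def \<epsilon>_def max_def field_simps)
    ultimately have exponent: "real Q + \<eta> t * real L \<le> real L * (1 - 1 / exp 1 + \<epsilon> t)"
      by (simp add: algebra_simps flip: \<open>1 / (real t * exp 1) + \<eta> t = \<epsilon> t\<close>)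
    have "real (card (domain M)) \<le> real (2 ^ Q * (9 * L\<^sup>2))" using M(3) by (simp only: of_nat_le_iff)
    also have "\<dots> = 2 powr real Q * (9 * (real L)\<^sup>2)" by (simp add: powr_realpow)
    also have "\<dots> \<le> 2 powr real Q * (9 * ((2 / (\<eta> t * ln 2))\<^sup>2 * 2 powr (\<eta> t * real L)))"
      using square_le_powr[OF \<eta>, of "real L" t] by (intro mult_left_mono) auto
    also have "\<dots> = C t * 2 powr (real Q + \<eta> t * real L)" by (simp add: C_def powr_add)
    also have "\<dots> \<le> C t * 2 powr (real L * (1 - 1 / exp 1 + \<epsilon> t))"
      using exponent \<open>C t > 0\<close> by (intro mult_left_mono) auto
    also have "\<dots> = C t * real (card (ktypes k (nf_sig ar \<phi>))) powr (1 - 1 / exp 1 + \<epsilon> t)"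
      unfolding types by (simp add: powr_powr)
    finally show ?thesis using M by blast
  qed
  ultimately show ?thesis by (intro exI[of _ C] exI[of _ \<epsilon>]) blast
qed

end
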